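(* Let $F:\mathbb{R}^d\to\mathbb{R}$ be differentiable, $\mu$-strongly convex and $L$-smooth with $L\ge\mu>0$, let $\kappa=L/\mu$, and suppose the stochastic gradients satisfy the noise model with constants $c,\sigma^2\ge 0$ described in the context. Choose the maximum number of communications, an integer $R$ with $1\le R\le\sqrt{2T}$, and set $a:=\lceil 2T/R^2\rceil\ge 1$, $H_i=a(i+1)$, $\tau_0=0$ and $\tau_{i+1}=\min(\tau_i+H_i,T)$ for $i=0,\ldots,R-1$; let $\mathcal{I}=\{\tau_i\mid i=1,\ldots,R\}$ be the set of communication times. Choose $$\beta\ge\max\Big\{2\kappa^2,\ 9\kappa^2c\,\max\Big\{\ln 3,\ \ln\Big(1+\frac{T}{R^2\kappa^2}\Big)\Big\}+2\kappa\Big(1+\frac cn\Big)\Big\}$$ and set $\eta_t=\frac{2}{\mu(t+\beta)}$ for $t=0,\ldots,T-1$. Then the iterates of Local SGD with $n$ workers, step sizes $\eta_t$ and communication times $\mathcal{I}$ satisfy $$\mathbb{E}[F(\bar{\mathbf{x}}^T)]-F^*\le\frac{\beta^2\,(F(\bar{\mathbf{x}}^0)-F^* )}{T^2}+\frac{2L\sigma^2}{n\mu^2T}+\frac{72L^2\sigma^2}{\mu^3TR},$$ where $F^*:=\min_{\mathbf{x}}F(\mathbf{x})$.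
   Context: Norms are Euclidean. $F$ is differentiable, $\mu$-strongly convex and $L$-smooth in the sense that for all $\mathbf{x},\mathbf{y}\in\mathbb{R}^d$, $$\frac{\mu}{2}\|\mathbf{x}-\mathbf{y}\|^2\le F(\mathbf{y})-F(\mathbf{x})-\langle\nabla F(\mathbf{x}),\mathbf{y}-\mathbf{x}\rangle\le\frac{L}{2}\|\mathbf{x}-\mathbf{y}\|^2 .$$ Local SGD: there are $n\ge1$ workers and $T\ge 1$ iterations, a set $\mathcal{I}\subseteq\{1,\ldots,T\}$ of communication times and step sizes $\eta_0,\ldots,\eta_{T-1}$. All workers start at a common deterministic point $\mathbf{x}_i^0=\mathbf{x}^0\in\mathbb{R}^d$, and for $t=0,\ldots,T-1$, $$\mathbf{x}_i^{t+1}=\begin{cases}\mathbf{x}_i^t-\eta_t\hat{\mathbf{g}}_i^t,& t+1\notin\mathcal{I},\\ \frac1n\sum_{j=1}^n(\mathbf{x}_j^t-\eta_t\hat{\mathbf{g}}_j^t),& t+1\in\mathcal{I},\end{cases}$$ where $\hat{\mathbf{g}}_i^t$ is worker $i$'s stochastic gradient at $\mathbf{x}_i^t$. The average iterate is $\bar{\mathbf{x}}^t:=\frac1n\sum_{i=1}^n\mathbf{x}_i^t$. Noise model (constants $c,\sigma^2\ge0$): $\hat{\mathbf{g}}_i^t=\nabla F(\mathbf{x}_i^t)+\boldsymbol{\epsilon}_i^t$. Let $\mathcal{F}^t$ be the information (sigma-algebra) generated by $\{\mathbf{x}_i^k,\hat{\mathbf{g}}_i^k: 1\le i\le n,\ 0\le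 k\le t-1\}\cup\{\mathbf{x}_i^t:1\le i\le n\}$. Conditionally on $\mathcal{F}^t$, the noises $\boldsymbol{\epsilon}_1^t,\ldots,\boldsymbol{\epsilon}_n^t$ are independent, $\mathbb{E}[\boldsymbol{\epsilon}_i^t\mid\mathcal{F}^t]=\mathbf{0}$, and $\mathbb{E}[\|\boldsymbol{\epsilon}_i^t\|^2\mid\mathcal{F}^t]\le c\|\nabla F(\mathbf{x}_i^t)\|^2+\sigma^2$. *)

theory Defs
  imports "HOL-Probability.Probability"
begin

text \<open>The two-sided quadratic bound; \<open>g\<close> is meant to be the gradient of \<open>F\<close>.\<close>

definition strongly_convex_smooth ::
    "real \<Rightarrow> real \<Rightarrow> ('a::real_inner \<Rightarrow> real) \<Rightarrow> ('a \<Rightarrow> 'a) \<Rightarrow> bool" where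
  "strongly_convex_smooth \<mu> L F g \<longleftrightarrow>
     (\<forall>x y. \<mu> / 2 * (norm (x - y))\<^sup>2 \<le> F y - F x - inner (g x) (y - x) \<and>
            F y - F x - inner (g x) (y - x) \<le> L / 2 * (norm (x - y))\<^sup>2)"

definition min_value :: "('a \<Rightarrow> real) \<Rightarrow> real" where
  "min_value F = (LEAST v. v \<in> range F)"

definition generated_algebra :: "'w measure \<Rightarrow> ('w \<Rightarrow> 'a::topological_space) set \<Rightarrow> 'w measure" where
  "generated_algebra M \<X> =
     sigma (space M) {X -` A \<inter> space M | X A. X \<in> \<X> \<and> A \<in> sets borel}"

text \<open>Conditional expectation of an integrable vector-valued random variable, coordinatewise.\<close>

definition vec_cond_exp ::
    "'w measure \<Rightarrow> 'w measure \<Rightarrow> ('w \<Rightarrow> 'a::euclidean_space) \<Rightarrow> 'w \<Rightarrow> 'a" where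
  "vec_cond_exp M G X \<omega> = (\<Sum>b\<in>Basis. real_cond_exp M G (\<lambda>\<xi>. inner (X \<xi>) b) \<omega> *\<^sub>R b)"

definition cond_prob_alg :: "'w measure \<Rightarrow> 'w measure \<Rightarrow> 'w set \<Rightarrow> 'w \<Rightarrow> real" where
  "cond_prob_alg M G A = real_cond_exp M G (indicator A)"

definition cond_indep_vars ::
    "'w measure \<Rightarrow> 'w measure \<Rightarrow> ('i \<Rightarrow> 'w \<Rightarrow> 'a::topological_space) \<Rightarrow> 'i set \<Rightarrow> bool" where
  "cond_indep_vars M G X I \<longleftrightarrow>
     (\<forall>i\<in>I. X i \<in> borel_measurable M) \<and>
     (\<forall>J A. J \<subseteq> I \<and> finite J \<and> (\<forall>i\<in>J. A i \<in> sets borel) \<longrightarrow>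
        (AE \<omega> in M. cond_prob_alg M G {\<xi> \<in> space M. \<forall>i\<in>J. X i \<xi> \<in> A i} \<omega> =
                     (\<Prod>i\<in>J. cond_prob_alg M G {\<xi> \<in> space M. X i \<xi> \<in> A i} \<omega>)))"

text \<open>Workers are indexed by \<open>{1..n}\<close>. Processes take the time first and the worker second;
  \<open>g t i\<close> is the random stochastic gradient of worker \<open>i\<close> at time \<open>t\<close>.\<close>

primrec local_sgd ::
    "nat \<Rightarrow> nat set \<Rightarrow> (nat \<Rightarrow> real) \<Rightarrow> 'a::real_vector \<Rightarrow> (nat \<Rightarrow> nat \<Rightarrow> 'w \<Rightarrow> 'a) \<Rightarrow>
     nat \<Rightarrow> nat \<Rightarrow> 'w \<Rightarrow> 'a" where
  "local_sgd n \<I> \<eta> x0 g 0 = (\<lambda>i \<omega>. x0)"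
| "local_sgd n \<I> \<eta> x0 g (Suc t) = (\<lambda>i \<omega>.
     if Suc t \<notin> \<I> then local_sgd n \<I> \<eta> x0 g t i \<omega> - \<eta> t *\<^sub>R g t i \<omega>
     else (1 / real n) *\<^sub>R
            (\<Sum>j\<in>{1..n}. local_sgd n \<I> \<eta> x0 g t j \<omega> - \<eta> t *\<^sub>R g t j \<omega>))"

definition average_iterate ::
    "nat \<Rightarrow> (nat \<Rightarrow> nat \<Rightarrow> 'w \<Rightarrow> 'a::real_vector) \<Rightarrow> nat \<Rightarrow> 'w \<Rightarrow> 'a" where
  "average_iterate n x t \<omega> = (1 / real n) *\<^sub>R (\<Sum>i\<in>{1..n}. x t i \<omega>)"

definition history ::
    "'w measure \<Rightarrow> nat \<Rightarrow> (nat \<Rightarrow> nat \<Rightarrow> 'w \<Rightarrow> 'a::topological_space) \<Rightarrow> (nat \<Rightarrow> nat \<Rightarrow> 'w \<Rightarrow> 'a) \<Rightarrow>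
     nat \<Rightarrow> 'w measure" where
  "history M n x g t = generated_algebra M
     ({x k i | k i. i \<in> {1..n} \<and> k < t} \<union> {g k i | k i. i \<in> {1..n} \<and> k < t} \<union>
      {x t i | i. i \<in> {1..n}})"

text \<open>The second moment is bounded through the nonnegative conditional expectation
  \<^const>\<open>nn_cond_exp\<close>, which is meaningful without any integrability assumption. Since the
  starting point is deterministic, the bound yields inductively that all iterates and all noises
  are square integrable, so that \<^const>\<open>vec_cond_exp\<close> is applied to integrable functions only.\<close>

definition noise_model ::
    "'w measure \<Rightarrow> nat \<Rightarrow> nat \<Rightarrow> real \<Rightarrow> real \<Rightarrow> ('a::euclidean_space \<Rightarrow> 'a) \<Rightarrow>
     (nat \<Rightarrow> nat \<Rightarrow> 'w \<Rightarrow> 'a) \<Rightarrow> (nat \<Rightarrow> nat \<Rightarrow> 'w \<Rightarrow> 'a) \<Rightarrow> bool" where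
  "noise_model M n T c \<sigma> gradF x g \<longleftrightarrow>
     (\<forall>t<T. \<forall>i\<in>{1..n}. g t i \<in> borel_measurable M) \<and>
     (\<forall>t<T.
        let G = history M n x g t; \<epsilon> = (\<lambda>i \<omega>. g t i \<omega> - gradF (x t i \<omega>)) in
          cond_indep_vars M G \<epsilon> {1..n} \<and>
          (\<forall>i\<in>{1..n}.
             (AE \<omega> in M. vec_cond_exp M G (\<epsilon> i) \<omega> = 0) \<and>
             (AE \<omega> in M. nn_cond_exp M G (\<lambda>\<xi>. ennreal ((norm (\<epsilon> i \<xi>))\<^sup>2)) \<omega>
                          \<le> ennreal (c * (norm (gradF (x t i \<omega>)))\<^sup>2 + \<sigma>\<^sup>2))))"

text \<open>With \<open>H i = a (i + 1)\<close>, this is the sequence \<open>\<tau>\<close> of communication times.\<close>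

primrec comm_time :: "(nat \<Rightarrow> nat) \<Rightarrow> nat \<Rightarrow> nat \<Rightarrow> nat" where
  "comm_time H T 0 = 0"
| "comm_time H T (Suc i) = min (comm_time H T i + H i) T"

end

theory Submission
  imports Defs
begin

text \<open>Let \<open>\<xi> t\<close> be the expected excess \<open>E F(z\<^sub>t) - F*\<close> at the average iterate \<open>z\<^sub>t\<close>, let \<open>V t\<close> be the
  expected spread of the workers around \<open>z\<^sub>t\<close>, and let \<open>G t\<close> be the average over the workers of
  \<open>E \<parallel>\<nabla>F(x\<^sub>i)\<parallel>\<^sup>2\<close>. The proof is a pair of one-step inequalities for these three sequences, followed
  by a purely deterministic summation.

  The average iterate makes a gradient step with a perturbed gradient (\<open>expected_descent\<close>). The
  perturbation costs \<open>\<eta> L\<^sup>2 V / 2\<close>; the noise enters with its variance divided by \<open>n\<close> because the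
  workers' noises are uncorrelated; and the step still leaves a negative multiple of \<open>G\<close>. That
  negative term is what later pays for the part \<open>c G\<close> of the noise.
  Between communications the spread satisfies \<open>V' \<le> (1 - \<mu> \<eta>) V + \<eta>\<^sup>2 (c G + \<sigma>\<^sup>2)\<close>
  (\<open>expected_spread_step\<close>), because an exact gradient step contracts the distance between two workers
  and uncorrelated noises add up in mean square; a communication resets \<open>V\<close> to \<open>0\<close>.

  With \<open>\<eta> t = 2 / (\<mu> (t + \<beta>))\<close>, multiplying either inequality by \<open>(t + \<beta>)\<^sup>2\<close> turns it into a telescoping
  sum (\<open>weighted_recursion\<close>). On a communication interval starting at \<open>p\<close> this bounds \<open>(t + \<beta>) V t\<close> by
  \<open>9 / (\<mu>\<^sup>2 (t + \<beta>))\<close> times the noise accumulated since \<open>p\<close> (\<open>block_spread_bound\<close>). The intervals have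
  lengths \<open>a, 2a, 3a, \<dots>\<close>, so each interval after the first is comparable to the time elapsed before it.
  Hence \<open>\<Sum> 1 / (t + \<beta>)\<close> over an interval is bounded by a logarithm (\<open>block_reciprocal_bound\<close>), which the
  lower bound on \<open>\<beta>\<close> lets the negative \<open>G\<close> term absorb, and every interval contributes at most \<open>2 a \<sigma>\<^sup>2\<close>,
  apart from the factor \<open>9 / \<mu>\<^sup>2\<close> (\<open>block_noise_bound\<close>). Since \<open>a \<le> 4 T / R\<^sup>2\<close>, the \<open>R\<close> intervals together contribute
  \<open>8 T \<sigma>\<^sup>2 / R\<close>, whence the constant \<open>72 = 9 \<cdot> 8\<close>.

  The probabilistic ingredients are that centered noise is orthogonal to everything determined by the
  past (\<open>centered_orthogonal_to_past\<close>) and that conditionally independent centered noises are orthogonal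
  to each other (\<open>cond_indep_centered_orthogonal\<close>).\<close>

section \<open>Mean and spread of a finite family of vectors\<close>

definition mean :: "nat \<Rightarrow> (nat \<Rightarrow> 'a::real_vector) \<Rightarrow> 'a" where
  "mean n v = (1 / real n) *\<^sub>R (\<Sum>i\<in>{1..n}. v i)"

text \<open>The mean squared deviation from the mean, written through pairwise differences: a pair of workers
  can be followed through one step without mentioning the mean, and equal entries visibly give \<open>0\<close>.\<close>

definition spread :: "nat \<Rightarrow> (nat \<Rightarrow> 'a::real_inner) \<Rightarrow> real" where
  "spread n v = (\<Sum>i\<in>{1..n}. \<Sum>j\<in>{1..n}. (norm (v i - v j))\<^sup>2) / (2 * (real n)\<^sup>2)"

lemma inner_mean: "inner x (mean n v) = (\<Sum>i\<in>{1..n}. inner x (v i)) / real n"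
  by (simp add: mean_def inner_sum_right)

lemma mean_const:
  assumes "n \<ge> 1"
  shows "mean n (\<lambda>_. v) = v"
proof -
  have "(\<Sum>i\<in>{1..n}. v) = real n *\<^sub>R v"
    by (simp only: sum_constant_scaleR card_atLeastAtMost diff_Suc_1 Suc_eq_plus1[symmetric])
  then show ?thesis
    using assms unfolding mean_def by (simp only: scaleR_scaleR) simp
qed

lemma mean_deviation:
  fixes v :: "nat \<Rightarrow> 'a::real_inner"
  assumes n: "n \<ge> 1"
  shows "(\<Sum>i\<in>{1..n}. (norm (mean n v - v i))\<^sup>2) / real n
       = (\<Sum>i\<in>{1..n}. (norm (v i))\<^sup>2) / real n - (norm (mean n v))\<^sup>2"
proof -
  have sum_v: "(\<Sum>i\<in>{1..n}. inner (mean n v) (v i)) = real n * (norm (mean n v))\<^sup>2"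
    using n inner_mean[of "mean n v" n v] by (simp add: power2_norm_eq_inner field_simps)
  have "(\<Sum>i\<in>{1..n}. (norm (mean n v - v i))\<^sup>2)
      = (\<Sum>i\<in>{1..n}. (norm (v i))\<^sup>2 - 2 * inner (mean n v) (v i) + (norm (mean n v))\<^sup>2)"
    by (intro sum.cong refl, simp only: power2_norm_eq_inner)
       (simp add: algebra_simps inner_commute)
  also have "\<dots> = (\<Sum>i\<in>{1..n}. (norm (v i))\<^sup>2) - 2 * (\<Sum>i\<in>{1..n}. inner (mean n v) (v i))
      + real n * (norm (mean n v))\<^sup>2"
    by (simp add: sum.distrib sum_subtractf sum_distrib_left)
  finally show ?thesis
    unfolding sum_v using n by (simp add: field_simps)
qed

lemma norm_mean_le:
  fixes v :: "nat \<Rightarrow> 'a::real_inner"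
  assumes "n \<ge> 1"
  shows "(norm (mean n v))\<^sup>2 \<le> (\<Sum>i\<in>{1..n}. (norm (v i))\<^sup>2) / real n"
proof -
  have "0 \<le> (\<Sum>i\<in>{1..n}. (norm (mean n v - v i))\<^sup>2) / real n"
    by (simp add: sum_nonneg)
  then show ?thesis using mean_deviation[OF assms, of v] by simp
qed

lemma spread_eq_mean_deviation:
  fixes v :: "nat \<Rightarrow> 'a::real_inner"
  assumes n: "n \<ge> 1"
  shows "spread n v = (\<Sum>i\<in>{1..n}. (norm (mean n v - v i))\<^sup>2) / real n"
proof -
  define q where "q = (\<Sum>i\<in>{1..n}. (norm (v i))\<^sup>2)"
  have cross: "(\<Sum>i\<in>{1..n}. \<Sum>j\<in>{1..n}. inner (v i) (v j)) = (real n)\<^sup>2 * (norm (mean n v))\<^sup>2"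
  proof -
    have "(\<Sum>i\<in>{1..n}. \<Sum>j\<in>{1..n}. inner (v i) (v j)) = inner (\<Sum>i\<in>{1..n}. v i) (\<Sum>j\<in>{1..n}. v j)"
      by (simp only: inner_sum_left) (simp only: inner_sum_right)
    also have "(\<Sum>i\<in>{1..n}. v i) = real n *\<^sub>R mean n v"
      using n by (simp add: mean_def)
    finally show ?thesis
      by (simp only: power2_norm_eq_inner) (simp add: power2_eq_square)
  qed
  have "(\<Sum>i\<in>{1..n}. \<Sum>j\<in>{1..n}. (norm (v i - v j))\<^sup>2)
      = (\<Sum>i\<in>{1..n}. \<Sum>j\<in>{1..n}. (norm (v i))\<^sup>2 + (norm (v j))\<^sup>2 - 2 * inner (v i) (v j))"
    by (intro sum.cong refl, simp only: power2_norm_eq_inner)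
       (simp add: algebra_simps inner_commute)
  also have "\<dots> = 2 * real n * q - 2 * (\<Sum>i\<in>{1..n}. \<Sum>j\<in>{1..n}. inner (v i) (v j))"
    by (simp add: sum.distrib sum_subtractf sum_distrib_left q_def mult.assoc)
  finally have "(\<Sum>i\<in>{1..n}. \<Sum>j\<in>{1..n}. (norm (v i - v j))\<^sup>2)
      = 2 * real n * q - 2 * ((real n)\<^sup>2 * (norm (mean n v))\<^sup>2)"
    by (simp only: cross)
  then show ?thesis
    unfolding spread_def mean_deviation[OF n] q_def[symmetric] using n
    by (simp add: field_simps power2_eq_square)
qed

section \<open>Smooth strongly convex functions\<close>

locale smooth_strongly_convex =
  fixes F :: "'a::euclidean_space \<Rightarrow> real" and gradF :: "'a \<Rightarrow> 'a" and \<mu> L :: real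
  assumes gradient: "\<And>y. GDERIV F y :> gradF y"
    and quadratic_bounds: "strongly_convex_smooth \<mu> L F gradF"
    and mu_pos: "\<mu> > 0" and mu_le_L: "\<mu> \<le> L"
begin

lemma L_pos: "L > 0"
  using mu_pos mu_le_L by simp

lemma quadratic_lower: "F x + inner (gradF x) (y - x) + \<mu> / 2 * (norm (x - y))\<^sup>2 \<le> F y"
  using quadratic_bounds unfolding strongly_convex_smooth_def by (smt (verit))

lemma quadratic_upper: "F y \<le> F x + inner (gradF x) (y - x) + L / 2 * (norm (x - y))\<^sup>2"
  using quadratic_bounds unfolding strongly_convex_smooth_def by (smt (verit))

lemma tangent_below: "F x + inner (gradF x) (y - x) \<le> F y"
proof -
  have "0 \<le> \<mu> / 2 * (norm (x - y))\<^sup>2"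
    using mu_pos by simp
  then show ?thesis
    using quadratic_lower[of x y] by linarith
qed

text \<open>The point \<open>y - (\<nabla>F y - \<nabla>F x) / L\<close> lies above the tangent at \<open>x\<close> by convexity and below the parabola
  at \<open>y\<close> by smoothness; comparing the two bounds there quantifies convexity by the gradients alone.\<close>

lemma tangent_gap_ge_gradient_gap:
  "F x + inner (gradF x) (y - x) + (norm (gradF y - gradF x))\<^sup>2 / (2 * L) \<le> F y"
proof -
  define \<Delta> where "\<Delta> = gradF y - gradF x"
  \<comment> \<open>A gradient step of length \<open>1 / L\<close> for \<open>F\<close> minus its tangent at \<open>x\<close>, which is minimal at \<open>x\<close>.\<close>
  define z where "z = y - (1 / L) *\<^sub>R \<Delta>"
  have zx: "inner (gradF x) (z - x) = inner (gradF x) (y - x) - inner (gradF x) \<Delta> / L"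
    unfolding z_def by (simp add: algebra_simps)
  have zy: "inner (gradF y) (z - y) = - inner (gradF y) \<Delta> / L"
    unfolding z_def by (simp add: algebra_simps)
  have nyz: "(norm (y - z))\<^sup>2 = (norm \<Delta>)\<^sup>2 / L\<^sup>2"
    unfolding z_def using L_pos by (simp add: power_divide)
  have "inner (gradF y) \<Delta> - inner (gradF x) \<Delta> = (norm \<Delta>)\<^sup>2"
    by (metis \<Delta>_def inner_diff_left power2_norm_eq_inner)
  then have nd: "inner (gradF y) \<Delta> / L - inner (gradF x) \<Delta> / L = (norm \<Delta>)\<^sup>2 / L"
    by (metis diff_divide_distrib)
  have "L / 2 * ((norm \<Delta>)\<^sup>2 / L\<^sup>2) = (norm \<Delta>)\<^sup>2 / L - (norm \<Delta>)\<^sup>2 / (2 * L)"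
    using L_pos by (simp add: field_simps power2_eq_square)
  with tangent_below[of x z] quadratic_upper[of z y] zx zy nyz nd show ?thesis
    unfolding \<Delta>_def by simp
qed

text \<open>Adding the previous inequality to its mirror image cancels the values of \<open>F\<close>.\<close>

lemma cocoercive:
  "(norm (gradF x - gradF y))\<^sup>2 \<le> L * inner (gradF x - gradF y) (x - y)"
proof -
  have "(norm (gradF x - gradF y))\<^sup>2 / L \<le> inner (gradF x - gradF y) (x - y)"
    using tangent_gap_ge_gradient_gap[of x y] tangent_gap_ge_gradient_gap[of y x] L_pos
    by (simp add: norm_minus_commute algebra_simps)
  then show ?thesis
    using L_pos by (simp add: field_simps)
qed

lemma strongly_monotone:
  "\<mu> * (norm (x - y))\<^sup>2 \<le> inner (gradF x - gradF y) (x - y)"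
  using quadratic_lower[of x y] quadratic_lower[of y x]
  by (simp add: norm_minus_commute algebra_simps)

lemma gradient_lipschitz: "norm (gradF x - gradF y) \<le> L * norm (x - y)"
proof (cases "gradF x = gradF y")
  case False
  have "norm (gradF x - gradF y) * norm (gradF x - gradF y)
          \<le> norm (gradF x - gradF y) * (L * norm (x - y))"
    using cocoercive[of x y] L_pos norm_cauchy_schwarz[of "gradF x - gradF y" "x - y"]
    by (smt (verit) mult.assoc mult.commute mult_left_mono power2_eq_square)
  then show ?thesis
    using False by simp
qed (use L_pos in simp)

text \<open>Cocoercivity absorbs the quadratic term \<open>h\<^sup>2 \<parallel>\<Delta>\<parallel>\<^sup>2\<close> into half of the linear term \<open>2 h \<langle>d, \<Delta>\<rangle>\<close>; strong
  monotonicity turns the other half into contraction. This is why an interval without communication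
  does not amplify the disagreement that noise has already created.\<close>

lemma gradient_step_contracts:
  assumes "0 \<le> h" "h * L \<le> 1"
  shows "(norm ((x - h *\<^sub>R gradF x) - (y - h *\<^sub>R gradF y)))\<^sup>2
           \<le> (1 - \<mu> * h) * (norm (x - y))\<^sup>2"
proof -
  define d \<Delta> where "d = x - y" and "\<Delta> = gradF x - gradF y"
  have dD: "\<mu> * (norm d)\<^sup>2 \<le> inner d \<Delta>" "(norm \<Delta>)\<^sup>2 \<le> L * inner d \<Delta>"
    using strongly_monotone[of x y] cocoercive[of x y]
    by (simp_all add: d_def \<Delta>_def inner_commute)
  have pos: "0 \<le> inner d \<Delta>"
    using dD(1) mu_pos by (smt (verit) mult_nonneg_nonneg zero_le_power2)
  have e: "(x - h *\<^sub>R gradF x) - (y - h *\<^sub>R gradF y) = d - h *\<^sub>R \<Delta>"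
    by (simp add: d_def \<Delta>_def algebra_simps)
  have "(norm (d - h *\<^sub>R \<Delta>))\<^sup>2 = (norm d)\<^sup>2 - 2 * h * inner d \<Delta> + h\<^sup>2 * (norm \<Delta>)\<^sup>2"
    by (simp only: power2_norm_eq_inner)
       (simp add: algebra_simps inner_commute power2_eq_square)
  also have "\<dots> \<le> (norm d)\<^sup>2 - 2 * h * inner d \<Delta> + h\<^sup>2 * (L * inner d \<Delta>)"
    using dD(2) by (simp add: mult_left_mono)
  also have "\<dots> = (norm d)\<^sup>2 - 2 * h * inner d \<Delta> + (h * L) * (h * inner d \<Delta>)"
    by (simp add: power2_eq_square)
  also have "\<dots> \<le> (norm d)\<^sup>2 - 2 * h * inner d \<Delta> + 1 * (h * inner d \<Delta>)"
    using assms pos by (intro add_left_mono mult_right_mono) auto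
  also have "\<dots> = (norm d)\<^sup>2 - h * inner d \<Delta>"
    by simp
  also have "\<dots> \<le> (norm d)\<^sup>2 - h * (\<mu> * (norm d)\<^sup>2)"
    using dD(1) assms(1) by (simp add: mult_left_mono)
  finally show ?thesis
    unfolding e d_def by (simp add: algebra_simps)
qed

text \<open>The lower quadratic bound minimised over \<open>y\<close>, that is, completing the square in \<open>y - x\<close>.\<close>

lemma gradient_dominates: "2 * \<mu> * (F x - F y) \<le> (norm (gradF x))\<^sup>2"
proof -
  have "0 \<le> (norm (gradF x + \<mu> *\<^sub>R (y - x)))\<^sup>2"
    by simp
  also have "\<dots> = (norm (gradF x))\<^sup>2 + 2 * \<mu> * inner (gradF x) (y - x) + \<mu>\<^sup>2 * (norm (x - y))\<^sup>2"
    by (simp only: power2_norm_eq_inner)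
       (simp add: algebra_simps inner_commute power2_eq_square)
  also have "\<dots> \<le> (norm (gradF x))\<^sup>2 - 2 * \<mu> * (F x - F y)"
    using mult_left_mono[OF quadratic_lower[of x y], of "2 * \<mu>"] mu_pos
    by (simp add: algebra_simps power2_eq_square)
  finally show ?thesis by simp
qed

lemma continuous_objective: "continuous_on UNIV F"
  using gradient by (intro continuous_at_imp_continuous_on ballI has_derivative_continuous)
    (auto simp: gderiv_def)

lemma continuous_gradient: "continuous_on UNIV gradF"
  by (rule lipschitz_on_continuous_on[where L = L], rule lipschitz_onI)
     (use gradient_lipschitz L_pos in \<open>auto simp: dist_norm\<close>)

lemma measurable_objective [measurable]: "F \<in> borel_measurable borel"
  by (rule borel_measurable_continuous_onI[OF continuous_objective])

lemma measurable_gradient [measurable]: "gradF \<in> borel_measurable borel"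
  by (rule borel_measurable_continuous_onI[OF continuous_gradient])

text \<open>Outside the ball of radius \<open>2 \<parallel>\<nabla>F 0\<parallel> / \<mu>\<close> the quadratic term of the lower bound at \<open>0\<close> beats the linear
  one, so values there are at least \<open>F 0\<close> and a minimiser over the compact ball is global.\<close>

lemma minimum_exists: "\<exists>z. \<forall>y. F z \<le> F y"
proof -
  define r where "r = 2 * norm (gradF 0) / \<mu>"
  have r: "r \<ge> 0" unfolding r_def using mu_pos by simp
  have "continuous_on (cball 0 r) F"
    using continuous_objective continuous_on_subset by blast
  moreover have "cball 0 r \<noteq> ({} :: 'a set)" using r by simp
  ultimately obtain z where z: "z \<in> cball 0 r" "\<And>y. y \<in> cball 0 r \<Longrightarrow> F z \<le> F y"
    using continuous_attains_inf[OF compact_cball] by blast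
  have "F z \<le> F y" for y
  proof (cases "norm y \<le> r")
    case False
    have "norm (gradF 0) * norm y \<le> \<mu> / 2 * (norm y)\<^sup>2"
    proof -
      have "norm (gradF 0) \<le> \<mu> / 2 * norm y"
        using False mu_pos unfolding r_def by (simp add: field_simps)
      then show ?thesis
        using mult_right_mono[of "norm (gradF 0)" "\<mu> / 2 * norm y" "norm y"]
        by (simp add: power2_eq_square)
    qed
    moreover have "\<bar>inner (gradF 0) y\<bar> \<le> norm (gradF 0) * norm y"
      by (rule Cauchy_Schwarz_ineq2)
    ultimately have "F 0 \<le> F y"
      using quadratic_lower[of 0 y] by simp
    moreover have "F z \<le> F 0" using z(2) r by simp
    ultimately show ?thesis by simp
  qed (use z in simp)
  then show ?thesis by blast
qed

lemma min_value_attained: "\<exists>z. min_value F = F z"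
  and min_value_le: "min_value F \<le> F y"
proof -
  obtain z where z: "\<And>y. F z \<le> F y" using minimum_exists by blast
  have "min_value F = F z"
    unfolding min_value_def by (rule Least_equality) (use z in auto)
  then show "\<exists>z. min_value F = F z" "min_value F \<le> F y"
    using z by auto
qed

lemma polyak_lojasiewicz: "2 * \<mu> * (F x - min_value F) \<le> (norm (gradF x))\<^sup>2"
  using min_value_attained gradient_dominates by metis

text \<open>One step from the mean \<open>z\<close> along \<open>m + e\<close>, where \<open>m\<close> averages the gradients at the \<open>x i\<close> and \<open>e\<close> is an
  arbitrary error. The polarisation \<open>2 \<langle>\<nabla>F z, \<nabla>F x\<^sub>i\<rangle> = \<parallel>\<nabla>F z\<parallel>\<^sup>2 + \<parallel>\<nabla>F x\<^sub>i\<parallel>\<^sup>2 - \<parallel>\<nabla>F z - \<nabla>F x\<^sub>i\<parallel>\<^sup>2\<close> splits the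
  progress into a term for gradient dominance, the useful term \<open>- h \<gamma> / 2\<close>, and a drift that smoothness
  bounds by the spread. The inner products with \<open>e\<close> are kept because they vanish in expectation.\<close>

lemma averaged_step_descent:
  fixes x :: "nat \<Rightarrow> 'a" and e :: 'a and n :: nat
  defines "\<gamma> \<equiv> (\<Sum>i\<in>{1..n}. (norm (gradF (x i)))\<^sup>2) / real n"
    and "m \<equiv> mean n (\<lambda>i. gradF (x i))"
  assumes n: "n \<ge> 1" and h: "h \<ge> 0"
  shows "F (mean n x - h *\<^sub>R (m + e))
      \<le> F (mean n x) - h * (\<mu> * (F (mean n x) - min_value F)) - h / 2 * \<gamma>
        + h * L\<^sup>2 / 2 * spread n x - h * inner (gradF (mean n x)) e
        + L * h\<^sup>2 / 2 * (\<gamma> + 2 * inner m e + (norm e)\<^sup>2)"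
proof -
  define z where "z = mean n x"
  have "(\<Sum>i\<in>{1..n}. (norm (gradF z - gradF (x i)))\<^sup>2) \<le> (\<Sum>i\<in>{1..n}. L\<^sup>2 * (norm (z - x i))\<^sup>2)"
    unfolding power_mult_distrib[symmetric]
    by (intro sum_mono power_mono gradient_lipschitz) auto
  also have "\<dots> = real n * (L\<^sup>2 * spread n x)"
    unfolding spread_eq_mean_deviation[OF n] z_def sum_distrib_left[symmetric] using n by simp
  finally have drift: "(\<Sum>i\<in>{1..n}. (norm (gradF z - gradF (x i)))\<^sup>2) \<le> real n * (L\<^sup>2 * spread n x)" .
  have "(\<Sum>i\<in>{1..n}. (norm (gradF z - gradF (x i)))\<^sup>2)
      = (\<Sum>i\<in>{1..n}. (norm (gradF z))\<^sup>2 + (norm (gradF (x i)))\<^sup>2 - 2 * inner (gradF z) (gradF (x i)))"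
    by (intro sum.cong refl, simp only: power2_norm_eq_inner)
       (simp add: algebra_simps inner_commute)
  also have "\<dots> = real n * ((norm (gradF z))\<^sup>2 + \<gamma> - 2 * inner (gradF z) m)"
    using n unfolding \<gamma>_def m_def inner_mean
    by (simp add: sum.distrib sum_subtractf sum_distrib_left[symmetric] algebra_simps)
  finally have "real n * ((norm (gradF z))\<^sup>2 + \<gamma> - 2 * inner (gradF z) m) \<le> real n * (L\<^sup>2 * spread n x)"
    using drift by simp
  then have "(norm (gradF z))\<^sup>2 + \<gamma> - 2 * inner (gradF z) m \<le> L\<^sup>2 * spread n x"
    using n by (simp del: of_nat_Suc)
  then have progress: "- inner (gradF z) m
      \<le> - (\<mu> * (F z - min_value F)) - \<gamma> / 2 + L\<^sup>2 / 2 * spread n x"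
    using polyak_lojasiewicz[of z] by simp
  have "(norm m)\<^sup>2 \<le> \<gamma>"
    unfolding m_def \<gamma>_def by (rule norm_mean_le[OF n])
  then have sq: "(norm (m + e))\<^sup>2 \<le> \<gamma> + 2 * inner m e + (norm e)\<^sup>2"
    by (simp add: power2_norm_eq_inner algebra_simps inner_commute)
  have "(norm (z - h *\<^sub>R (m + e) - z))\<^sup>2 = h\<^sup>2 * (norm (m + e))\<^sup>2"
    by (simp add: power_mult_distrib)
  then have "F (z - h *\<^sub>R (m + e))
      \<le> F z + h * (- inner (gradF z) m) - h * inner (gradF z) e + L * h\<^sup>2 / 2 * (norm (m + e))\<^sup>2"
    using quadratic_upper[of "z - h *\<^sub>R (m + e)" z]
    by (simp add: norm_minus_commute inner_add_right distrib_left)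
  also have "\<dots> \<le> F z + h * (- (\<mu> * (F z - min_value F)) - \<gamma> / 2 + L\<^sup>2 / 2 * spread n x)
      - h * inner (gradF z) e + L * h\<^sup>2 / 2 * (\<gamma> + 2 * inner m e + (norm e)\<^sup>2)"
    using progress sq h L_pos by (intro add_mono diff_mono mult_left_mono order_refl) auto
  also have "\<dots> = F z - h * (\<mu> * (F z - min_value F)) - h / 2 * \<gamma>
        + h * L\<^sup>2 / 2 * spread n x - h * inner (gradF z) e
        + L * h\<^sup>2 / 2 * (\<gamma> + 2 * inner m e + (norm e)\<^sup>2)"
    by (simp add: algebra_simps)
  finally show ?thesis unfolding z_def .
qed

end

section \<open>Square-integrable random vectors and conditional independence\<close>

definition square_integrable :: "'w measure \<Rightarrow> ('w \<Rightarrow> 'a::euclidean_space) \<Rightarrow> bool" where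
  "square_integrable M X \<longleftrightarrow> X \<in> borel_measurable M \<and> integrable M (\<lambda>\<omega>. (norm (X \<omega>))\<^sup>2)"

lemma square_integrable_measurable [measurable_dest]:
  "square_integrable M X \<Longrightarrow> X \<in> borel_measurable M"
  by (simp add: square_integrable_def)

lemma square_integrable_norm:
  "square_integrable M X \<Longrightarrow> integrable M (\<lambda>\<omega>. (norm (X \<omega>))\<^sup>2)"
  by (simp add: square_integrable_def)

lemma square_integrable_inner:
  assumes [measurable_dest]: "square_integrable M X" "square_integrable M Y"
  shows "integrable M (\<lambda>\<omega>. inner (X \<omega>) (Y \<omega>))"
proof (rule Bochner_Integration.integrable_bound)
  show "integrable M (\<lambda>\<omega>. (norm (X \<omega>))\<^sup>2 + (norm (Y \<omega>))\<^sup>2)"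
    using assms by (intro Bochner_Integration.integrable_add square_integrable_norm)
  have "\<bar>inner x y\<bar> \<le> (norm x)\<^sup>2 + (norm y)\<^sup>2" for x y :: 'b
  proof -
    have "\<bar>inner x y\<bar> \<le> norm x * norm y"
      by (rule Cauchy_Schwarz_ineq2)
    also have "\<dots> \<le> 2 * (norm x * norm y)" by simp
    also have "\<dots> \<le> (norm x)\<^sup>2 + (norm y)\<^sup>2"
      using sum_squares_bound[of "norm x" "norm y"] by simp
    finally show ?thesis .
  qed
  then show "AE \<omega> in M. norm (inner (X \<omega>) (Y \<omega>)) \<le> norm ((norm (X \<omega>))\<^sup>2 + (norm (Y \<omega>))\<^sup>2)"
    by simp
qed (use assms in measurable)

lemma square_integrable_scaleR:
  "square_integrable M X \<Longrightarrow> square_integrable M (\<lambda>\<omega>. r *\<^sub>R X \<omega>)"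
  unfolding square_integrable_def by (auto simp: power_mult_distrib)

lemma square_integrable_add:
  assumes "square_integrable M X" "square_integrable M Y"
  shows "square_integrable M (\<lambda>\<omega>. X \<omega> + Y \<omega>)"
proof -
  have "integrable M (\<lambda>\<omega>. inner (X \<omega> + Y \<omega>) (X \<omega> + Y \<omega>))"
    unfolding inner_add_left inner_add_right
    using assms by (intro Bochner_Integration.integrable_add square_integrable_inner)
  then show ?thesis
    using assms unfolding square_integrable_def power2_norm_eq_inner by auto
qed

lemma square_integrable_diff:
  assumes "square_integrable M X" "square_integrable M Y"
  shows "square_integrable M (\<lambda>\<omega>. X \<omega> - Y \<omega>)"
  using square_integrable_add[OF assms(1) square_integrable_scaleR[OF assms(2), of "-1"]] by simp

lemma (in finite_measure) square_integrable_const: "square_integrable M (\<lambda>_. x)"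
  by (simp add: square_integrable_def)

lemma (in finite_measure) square_integrable_sum:
  assumes "\<And>i. i \<in> I \<Longrightarrow> square_integrable M (X i)"
  shows "square_integrable M (\<lambda>\<omega>. \<Sum>i\<in>I. X i \<omega>)"
  using assms
  by (induction I rule: infinite_finite_induct)
     (auto intro: square_integrable_add square_integrable_const)

lemma (in finite_measure) square_integrable_linear_growth:
  assumes "square_integrable M X" and [measurable]: "f \<in> borel_measurable borel"
    and growth: "\<And>x. norm (f x) \<le> A + B * norm x" and "A \<ge> 0" "B \<ge> 0"
  shows "square_integrable M (\<lambda>\<omega>. f (X \<omega>))"
proof -
  note [measurable] = square_integrable_measurable[OF assms(1)]
  have "(norm (f x))\<^sup>2 \<le> 2 * A\<^sup>2 + 2 * B\<^sup>2 * (norm x)\<^sup>2" for x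
  proof -
    have "(norm (f x))\<^sup>2 \<le> (A + B * norm x)\<^sup>2"
      by (intro power_mono growth) auto
    also have "\<dots> \<le> 2 * A\<^sup>2 + 2 * B\<^sup>2 * (norm x)\<^sup>2"
      using sum_squares_bound[of A "B * norm x"] by (simp add: power2_eq_square algebra_simps)
    finally show ?thesis .
  qed
  then have "AE \<omega> in M. norm ((norm (f (X \<omega>)))\<^sup>2) \<le> norm (2 * A\<^sup>2 + 2 * B\<^sup>2 * (norm (X \<omega>))\<^sup>2)"
    by (intro AE_I2) (smt (verit) norm_power power2_norm_eq_inner real_norm_def zero_le_power2)
  then have "integrable M (\<lambda>\<omega>. (norm (f (X \<omega>)))\<^sup>2)"
    by (rule Bochner_Integration.integrable_bound[rotated 2])
       (use square_integrable_norm[OF assms(1)] in auto)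
  then show ?thesis unfolding square_integrable_def by auto
qed

lemma (in finite_measure) square_integrable_coordinate:
  "square_integrable M X \<Longrightarrow> integrable M (\<lambda>\<omega>. inner (X \<omega>) b)"
  by (intro square_integrable_inner square_integrable_const)

lemma square_integrable_coordinate_mult:
  assumes "square_integrable M X" "square_integrable M Y"
  shows "integrable M (\<lambda>\<omega>. inner (X \<omega>) b * inner (Y \<omega>) b)"
proof -
  have "square_integrable M (\<lambda>\<omega>. inner (Z \<omega>) b *\<^sub>R b)" if "square_integrable M Z" for Z :: "_ \<Rightarrow> 'b"
  proof -
    note [measurable] = square_integrable_measurable[OF that]
    have *: "(norm (inner x b *\<^sub>R b))\<^sup>2 \<le> (norm b * norm b)\<^sup>2 * (norm x)\<^sup>2" for x
    proof -
      have "\<bar>inner x b\<bar> * norm b \<le> norm x * norm b * norm b"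
        by (intro mult_right_mono Cauchy_Schwarz_ineq2) auto
      then have "(\<bar>inner x b\<bar> * norm b)\<^sup>2 \<le> (norm x * norm b * norm b)\<^sup>2"
        by (intro power_mono) auto
      then show ?thesis by (simp add: power_mult_distrib mult_ac)
    qed
    have "integrable M (\<lambda>\<omega>. (norm (inner (Z \<omega>) b *\<^sub>R b))\<^sup>2)"
      by (rule Bochner_Integration.integrable_bound
            [of M "\<lambda>\<omega>. (norm b * norm b)\<^sup>2 * (norm (Z \<omega>))\<^sup>2"])
         (use * square_integrable_norm[OF that] in auto)
    then show ?thesis unfolding square_integrable_def by auto
  qed
  note c = this
  have "integrable M (\<lambda>\<omega>. inner (inner (X \<omega>) b *\<^sub>R b) (Y \<omega>))"
    by (intro square_integrable_inner c assms)
  then show ?thesis by (simp add: inner_commute)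
qed

text \<open>The hypothesis says that the densities \<open>u\<close> and \<open>v\<close> push forward along \<open>Y\<close> to the same measure.
  Passing through push-forwards replaces an approximation of \<open>h\<close> by simple functions.\<close>

lemma nn_integral_weight_eqI:
  fixes u v :: "'w \<Rightarrow> ennreal" and h :: "'b::topological_space \<Rightarrow> ennreal"
  assumes [measurable]: "u \<in> borel_measurable M" "v \<in> borel_measurable M"
      "Y \<in> borel_measurable M" "h \<in> borel_measurable borel"
    and eq: "\<And>B. B \<in> sets borel \<Longrightarrow>
      (\<integral>\<^sup>+\<omega>. u \<omega> * indicator B (Y \<omega>) \<partial>M) = (\<integral>\<^sup>+\<omega>. v \<omega> * indicator B (Y \<omega>) \<partial>M)"
  shows "(\<integral>\<^sup>+\<omega>. u \<omega> * h (Y \<omega>) \<partial>M) = (\<integral>\<^sup>+\<omega>. v \<omega> * h (Y \<omega>) \<partial>M)"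
proof -
  have law: "emeasure (distr (density M w) borel Y) B = (\<integral>\<^sup>+\<omega>. w \<omega> * indicator B (Y \<omega>) \<partial>M)"
    if [measurable]: "w \<in> borel_measurable M" "B \<in> sets borel" for w B
  proof -
    have "emeasure (distr (density M w) borel Y) B
        = (\<integral>\<^sup>+\<omega>. w \<omega> * indicator (Y -` B \<inter> space M) \<omega> \<partial>M)"
      by (simp add: emeasure_distr emeasure_density)
    also have "\<dots> = (\<integral>\<^sup>+\<omega>. w \<omega> * indicator B (Y \<omega>) \<partial>M)"
      by (rule nn_integral_cong) (auto simp: indicator_def)
    finally show ?thesis .
  qed
  have "distr (density M u) borel Y = distr (density M v) borel Y"
    by (rule measure_eqI) (auto simp: law eq)
  then have "(\<integral>\<^sup>+y. h y \<partial>distr (density M u) borel Y) = (\<integral>\<^sup>+y. h y \<partial>distr (density M v) borel Y)"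
    by simp
  then show ?thesis
    by (simp add: nn_integral_distr nn_integral_density)
qed

lemma cond_indep_pair:
  assumes "cond_indep_vars M G X I" "i \<in> I" "j \<in> I" "i \<noteq> j" "A \<in> sets borel" "B \<in> sets borel"
  shows "AE \<omega> in M. cond_prob_alg M G {\<xi> \<in> space M. X i \<xi> \<in> A \<and> X j \<xi> \<in> B} \<omega>
      = cond_prob_alg M G {\<xi> \<in> space M. X i \<xi> \<in> A} \<omega> * cond_prob_alg M G {\<xi> \<in> space M. X j \<xi> \<in> B} \<omega>"
proof -
  define S where "S = (\<lambda>k. if k = i then A else B)"
  have "AE \<omega> in M. cond_prob_alg M G {\<xi> \<in> space M. \<forall>k\<in>{i, j}. X k \<xi> \<in> S k} \<omega> =
          (\<Prod>k\<in>{i, j}. cond_prob_alg M G {\<xi> \<in> space M. X k \<xi> \<in> S k} \<omega>)"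
    using assms(1)[unfolded cond_indep_vars_def, THEN conjunct2, rule_format, of "{i, j}" S] assms
    by (auto simp: S_def)
  then show ?thesis
    using assms(4) by (simp add: S_def)
qed

context finite_measure_subalgebra
begin

text \<open>Conditional independence lets the event \<open>X j \<in> B\<close> be replaced by its conditional probability as far as
  functions of \<open>X i\<close> are concerned. For indicators both sides equal the probability of the joint event;
  the general case then follows by comparing push-forwards along \<open>X i\<close>.\<close>

lemma cond_indep_conditional_weight:
  fixes X :: "'i \<Rightarrow> 'a \<Rightarrow> 'b::topological_space" and h :: "'b \<Rightarrow> ennreal"
  assumes ind: "cond_indep_vars M F X I" and ij: "i \<in> I" "j \<in> I" "i \<noteq> j"
    and B [measurable]: "B \<in> sets borel" and [measurable]: "h \<in> borel_measurable borel"
  shows "(\<integral>\<^sup>+\<omega>. indicator B (X j \<omega>) * h (X i \<omega>) \<partial>M)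
       = (\<integral>\<^sup>+\<omega>. ennreal (cond_prob_alg M F {\<xi> \<in> space M. X j \<xi> \<in> B} \<omega>) * h (X i \<omega>) \<partial>M)"
proof (rule nn_integral_weight_eqI[where Y = "X i" and h = h])
  have [measurable]: "X i \<in> borel_measurable M" "X j \<in> borel_measurable M"
    using ind ij unfolding cond_indep_vars_def by auto
  show "X i \<in> borel_measurable M" by measurable
  show "(\<lambda>\<omega>. indicator B (X j \<omega>)) \<in> borel_measurable M" by measurable
  define p where "p = (\<lambda>S. cond_prob_alg M F {\<xi> \<in> space M. S \<xi>})"
  have [measurable]: "p S \<in> borel_measurable F" "p S \<in> borel_measurable M" for S
    unfolding p_def cond_prob_alg_def by measurable
  show "(\<lambda>\<omega>. ennreal (cond_prob_alg M F {\<xi> \<in> space M. X j \<xi> \<in> B} \<omega>)) \<in> borel_measurable M"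
    using \<open>p (\<lambda>\<xi>. X j \<xi> \<in> B) \<in> borel_measurable M\<close> by (simp add: p_def)
  fix A :: "'b set" assume A [measurable]: "A \<in> sets borel"
  let ?PX = "p (\<lambda>\<xi>. X i \<xi> \<in> A)" and ?PY = "p (\<lambda>\<xi>. X j \<xi> \<in> B)"
    and ?SX = "{\<xi> \<in> space M. X i \<xi> \<in> A}" and ?SY = "{\<xi> \<in> space M. X j \<xi> \<in> B}"
    and ?SXY = "{\<xi> \<in> space M. X i \<xi> \<in> A \<and> X j \<xi> \<in> B}"
  have int: "integrable M (indicator S :: _ \<Rightarrow> real)" if "S \<in> sets M" for S
    using that by (simp add: emeasure_finite less_top[symmetric])
  have PY: "integrable M ?PY" "AE \<omega> in M. 0 \<le> ?PY \<omega>"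
    unfolding p_def cond_prob_alg_def by (auto intro!: real_cond_exp_int real_cond_exp_pos int)
  have PYX: "integrable M (\<lambda>\<omega>. ?PY \<omega> * indicator ?SX \<omega>)"
    using PY by (intro integrable_real_mult_indicator) auto
  have "measure M ?SXY = (\<integral>\<omega>. indicator ?SXY \<omega> \<partial>M)"
    by (simp add: Int_absorb2 subset_eq)
  also have "\<dots> = (\<integral>\<omega>. cond_prob_alg M F ?SXY \<omega> \<partial>M)"
    unfolding cond_prob_alg_def by (intro real_cond_exp_int(2)[symmetric] int) auto
  also have "\<dots> = (\<integral>\<omega>. ?PX \<omega> * ?PY \<omega> \<partial>M)"
    using cond_indep_pair[OF ind ij A B]
    by (intro integral_cong_AE) (auto simp: p_def cond_prob_alg_def)
  also have "\<dots> = (\<integral>\<omega>. ?PY \<omega> * real_cond_exp M F (indicator ?SX) \<omega> \<partial>M)"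
    by (simp add: p_def cond_prob_alg_def mult.commute)
  also have "\<dots> = (\<integral>\<omega>. ?PY \<omega> * indicator ?SX \<omega> \<partial>M)"
    by (rule real_cond_exp_intg(2)[OF PYX]) auto
  finally have eq: "measure M ?SXY = (\<integral>\<omega>. ?PY \<omega> * indicator ?SX \<omega> \<partial>M)" .
  have "(\<integral>\<^sup>+\<omega>. indicator B (X j \<omega>) * indicator A (X i \<omega>) \<partial>M) = (\<integral>\<^sup>+\<omega>. indicator ?SXY \<omega> \<partial>M)"
    by (rule nn_integral_cong) (auto simp: indicator_def)
  also have "\<dots> = ennreal (measure M ?SXY)"
    by (simp add: emeasure_eq_measure)
  also have "\<dots> = (\<integral>\<^sup>+\<omega>. ennreal (?PY \<omega> * indicator ?SX \<omega>) \<partial>M)"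
    unfolding eq using PY(2) by (intro nn_integral_eq_integral[symmetric] PYX) auto
  also have "\<dots> = (\<integral>\<^sup>+\<omega>. ennreal (?PY \<omega>) * indicator A (X i \<omega>) \<partial>M)"
    by (rule nn_integral_cong) (auto simp: indicator_def)
  finally show "(\<integral>\<^sup>+\<omega>. indicator B (X j \<omega>) * indicator A (X i \<omega>) \<partial>M)
      = (\<integral>\<^sup>+\<omega>. ennreal (cond_prob_alg M F ?SY \<omega>) * indicator A (X i \<omega>) \<partial>M)"
    by (simp add: p_def)
qed simp

text \<open>After replacing the event \<open>X j \<in> B\<close> by its conditional probability \<open>p\<close>, the signed integral is that of
  \<open>p\<close> times the conditional expectation of \<open>f (X i)\<close>, which is zero. The statement compares positive and
  negative parts as nonnegative integrals, the form to which push-forwards along \<open>X j\<close> apply.\<close>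

lemma cond_indep_centered_set_integral:
  fixes X :: "'i \<Rightarrow> 'a \<Rightarrow> 'b::topological_space" and f :: "'b \<Rightarrow> real"
  assumes ind: "cond_indep_vars M F X I" and ij: "i \<in> I" "j \<in> I" "i \<noteq> j"
    and B [measurable]: "B \<in> sets borel" and f [measurable]: "f \<in> borel_measurable borel"
    and fX: "integrable M (\<lambda>\<omega>. f (X i \<omega>))"
    and centered: "AE \<omega> in M. real_cond_exp M F (\<lambda>\<omega>. f (X i \<omega>)) \<omega> = 0"
  shows "(\<integral>\<^sup>+\<omega>. ennreal (f (X i \<omega>)) * indicator B (X j \<omega>) \<partial>M)
       = (\<integral>\<^sup>+\<omega>. ennreal (- f (X i \<omega>)) * indicator B (X j \<omega>) \<partial>M)"
proof -
  have [measurable]: "X i \<in> borel_measurable M" "X j \<in> borel_measurable M"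
    using ind ij unfolding cond_indep_vars_def by auto
  define p where "p = cond_prob_alg M F {\<xi> \<in> space M. X j \<xi> \<in> B}"
  have [measurable]: "p \<in> borel_measurable F" "p \<in> borel_measurable M"
    unfolding p_def cond_prob_alg_def by measurable
  have p_pos: "AE \<omega> in M. 0 \<le> p \<omega>"
    unfolding p_def cond_prob_alg_def by (intro real_cond_exp_pos) auto
  have weight: "(\<integral>\<^sup>+\<omega>. ennreal (g (X i \<omega>)) * indicator B (X j \<omega>) \<partial>M) = (\<integral>\<^sup>+\<omega>. ennreal (p \<omega> * g (X i \<omega>)) \<partial>M)"
    if [measurable]: "g \<in> borel_measurable borel" for g :: "'b \<Rightarrow> real"
  proof -
    have "(\<integral>\<^sup>+\<omega>. ennreal (g (X i \<omega>)) * indicator B (X j \<omega>) \<partial>M)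
        = (\<integral>\<^sup>+\<omega>. indicator B (X j \<omega>) * ennreal (g (X i \<omega>)) \<partial>M)"
      by (simp add: mult.commute)
    also have "\<dots> = (\<integral>\<^sup>+\<omega>. ennreal (p \<omega>) * ennreal (g (X i \<omega>)) \<partial>M)"
      unfolding p_def by (rule cond_indep_conditional_weight[OF ind ij B]) measurable
    also have "\<dots> = (\<integral>\<^sup>+\<omega>. ennreal (p \<omega> * g (X i \<omega>)) \<partial>M)"
      by (rule nn_integral_cong_AE, use p_pos in eventually_elim) (simp add: ennreal_mult')
    finally show ?thesis .
  qed
  have fin: "(\<integral>\<^sup>+\<omega>. ennreal \<bar>f (X i \<omega>)\<bar> * indicator B (X j \<omega>) \<partial>M) < \<infinity>"
  proof -
    have "(\<integral>\<^sup>+\<omega>. ennreal \<bar>f (X i \<omega>)\<bar> * indicator B (X j \<omega>) \<partial>M) \<le> (\<integral>\<^sup>+\<omega>. ennreal \<bar>f (X i \<omega>)\<bar> \<partial>M)"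
      by (rule nn_integral_mono) (auto simp: indicator_def)
    also have "\<dots> < \<infinity>"
      using fX by (auto simp: integrable_iff_bounded)
    finally show ?thesis .
  qed
  have int: "integrable M (\<lambda>\<omega>. p \<omega> * f (X i \<omega>))"
  proof (rule integrableI_bounded)
    have "(\<integral>\<^sup>+\<omega>. ennreal (norm (p \<omega> * f (X i \<omega>))) \<partial>M) = (\<integral>\<^sup>+\<omega>. ennreal (p \<omega> * \<bar>f (X i \<omega>)\<bar>) \<partial>M)"
      by (rule nn_integral_cong_AE, use p_pos in eventually_elim) (simp add: abs_mult)
    also have "\<dots> < \<infinity>"
      using fin weight[of "\<lambda>x. \<bar>f x\<bar>"] by simp
    finally show "(\<integral>\<^sup>+\<omega>. ennreal (norm (p \<omega> * f (X i \<omega>))) \<partial>M) < \<infinity>" .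
  qed measurable
  have "(\<integral>\<omega>. p \<omega> * f (X i \<omega>) \<partial>M) = (\<integral>\<omega>. p \<omega> * real_cond_exp M F (\<lambda>\<omega>. f (X i \<omega>)) \<omega> \<partial>M)"
    by (rule real_cond_exp_intg(2)[symmetric, OF int]) measurable
  also have "\<dots> = (\<integral>\<omega>. 0 \<partial>M)"
    by (rule integral_cong_AE) (use centered in auto)
  finally have zero: "(\<integral>\<omega>. p \<omega> * f (X i \<omega>) \<partial>M) = 0" by simp
  let ?a = "\<integral>\<^sup>+\<omega>. ennreal (p \<omega> * f (X i \<omega>)) \<partial>M" and ?b = "\<integral>\<^sup>+\<omega>. ennreal (- (p \<omega> * f (X i \<omega>))) \<partial>M"
  have "enn2real ?a = enn2real ?b"
    using zero real_lebesgue_integral_def[OF int] by simp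
  moreover have "?a \<noteq> \<infinity>" "?b \<noteq> \<infinity>"
    using int by (auto simp: real_integrable_def)
  then have "ennreal (enn2real ?a) = ?a" "ennreal (enn2real ?b) = ?b"
    by (simp_all add: less_top)
  ultimately have "?a = ?b" by metis
  then show ?thesis
    using weight[of f] weight[of "\<lambda>x. - f x"] by simp
qed

text \<open>The positive and negative parts of \<open>f (X i)\<close> have the same push-forward along \<open>X j\<close>, so exchanging them
  turns the positive part of the product into its negative part.\<close>

lemma cond_indep_centered_integral_mult:
  fixes X :: "'i \<Rightarrow> 'a \<Rightarrow> 'b::topological_space" and f g :: "'b \<Rightarrow> real"
  assumes ind: "cond_indep_vars M F X I" and ij: "i \<in> I" "j \<in> I" "i \<noteq> j"
    and f [measurable]: "f \<in> borel_measurable borel" and g [measurable]: "g \<in> borel_measurable borel"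
    and fX: "integrable M (\<lambda>\<omega>. f (X i \<omega>))"
    and fg: "integrable M (\<lambda>\<omega>. f (X i \<omega>) * g (X j \<omega>))"
    and centered: "AE \<omega> in M. real_cond_exp M F (\<lambda>\<omega>. f (X i \<omega>)) \<omega> = 0"
  shows "(\<integral>\<omega>. f (X i \<omega>) * g (X j \<omega>) \<partial>M) = 0"
proof -
  have [measurable]: "X i \<in> borel_measurable M" "X j \<in> borel_measurable M"
    using ind ij unfolding cond_indep_vars_def by auto
  have swap: "(\<integral>\<^sup>+\<omega>. ennreal (f (X i \<omega>)) * h (X j \<omega>) \<partial>M) = (\<integral>\<^sup>+\<omega>. ennreal (- f (X i \<omega>)) * h (X j \<omega>) \<partial>M)"
    if [measurable]: "h \<in> borel_measurable borel" for h
  proof (rule nn_integral_weight_eqI[where Y = "X j" and h = h])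
    show "(\<integral>\<^sup>+\<omega>. ennreal (f (X i \<omega>)) * indicator B (X j \<omega>) \<partial>M)
        = (\<integral>\<^sup>+\<omega>. ennreal (- f (X i \<omega>)) * indicator B (X j \<omega>) \<partial>M)" if "B \<in> sets borel" for B
      by (rule cond_indep_centered_set_integral[OF ind ij that f fX centered])
  qed measurable
  \<comment> \<open>The conversion to nonnegative extended reals truncates at \<open>0\<close>, so this is the positive part of a product.\<close>
  have split: "ennreal (a * b) = ennreal a * ennreal b + ennreal (- a) * ennreal (- b)" for a b :: real
    by (cases "0 \<le> a"; cases "0 \<le> b")
       (auto simp: ennreal_mult[symmetric] ennreal_neg mult_nonneg_nonpos mult_nonpos_nonneg)
  have "(\<integral>\<^sup>+\<omega>. ennreal (f (X i \<omega>) * g (X j \<omega>)) \<partial>M)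
      = (\<integral>\<^sup>+\<omega>. ennreal (f (X i \<omega>)) * ennreal (g (X j \<omega>)) \<partial>M)
        + (\<integral>\<^sup>+\<omega>. ennreal (- f (X i \<omega>)) * ennreal (- g (X j \<omega>)) \<partial>M)"
    unfolding split by (rule nn_integral_add) measurable
  also have "\<dots> = (\<integral>\<^sup>+\<omega>. ennreal (- f (X i \<omega>)) * ennreal (g (X j \<omega>)) \<partial>M)
        + (\<integral>\<^sup>+\<omega>. ennreal (f (X i \<omega>)) * ennreal (- g (X j \<omega>)) \<partial>M)"
    using swap[of "\<lambda>x. ennreal (g x)"] swap[of "\<lambda>x. ennreal (- g x)"] by simp
  also have "\<dots> = (\<integral>\<^sup>+\<omega>. ennreal (- f (X i \<omega>)) * ennreal (g (X j \<omega>))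
                       + ennreal (f (X i \<omega>)) * ennreal (- g (X j \<omega>)) \<partial>M)"
    by (rule nn_integral_add[symmetric]) measurable
  also have "\<dots> = (\<integral>\<^sup>+\<omega>. ennreal (- (f (X i \<omega>) * g (X j \<omega>))) \<partial>M)"
    using split[of "- f (X i \<omega>)" "g (X j \<omega>)" for \<omega>] by simp
  finally show ?thesis
    by (simp add: real_lebesgue_integral_def[OF fg])
qed

lemma vec_cond_exp_zero_coordinate:
  assumes "AE \<omega> in M. vec_cond_exp M F X \<omega> = 0" and b: "b \<in> Basis"
  shows "AE \<omega> in M. real_cond_exp M F (\<lambda>\<xi>. inner (X \<xi>) b) \<omega> = 0"
  using assms(1)
proof eventually_elim
  case (elim \<omega>)
  have "real_cond_exp M F (\<lambda>\<xi>. inner (X \<xi>) b) \<omega> = inner (vec_cond_exp M F X \<omega>) b"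
    unfolding vec_cond_exp_def inner_sum_left_Basis[OF b] ..
  then show ?case using elim by simp
qed

lemma centered_orthogonal_to_past:
  assumes Y: "square_integrable M Y" and YF: "Y \<in> borel_measurable F"
    and X: "square_integrable M X" and centered: "AE \<omega> in M. vec_cond_exp M F X \<omega> = 0"
  shows "(\<integral>\<omega>. inner (Y \<omega>) (X \<omega>) \<partial>M) = 0"
proof -
  note [measurable] = square_integrable_measurable[OF X] YF
  have "(\<integral>\<omega>. inner (Y \<omega>) (X \<omega>) \<partial>M) = (\<integral>\<omega>. (\<Sum>b\<in>Basis. inner (Y \<omega>) b * inner (X \<omega>) b) \<partial>M)"
    by (rule Bochner_Integration.integral_cong[OF refl euclidean_inner])
  also have "\<dots> = (\<Sum>b\<in>Basis. \<integral>\<omega>. inner (Y \<omega>) b * inner (X \<omega>) b \<partial>M)"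
    by (intro Bochner_Integration.integral_sum square_integrable_coordinate_mult X Y)
  also have "\<dots> = (\<Sum>b\<in>(Basis :: 'b set). 0)"
  proof (rule sum.cong)
    fix b :: 'b assume b: "b \<in> Basis"
    have "(\<integral>\<omega>. inner (Y \<omega>) b * inner (X \<omega>) b \<partial>M)
        = (\<integral>\<omega>. inner (Y \<omega>) b * real_cond_exp M F (\<lambda>\<xi>. inner (X \<xi>) b) \<omega> \<partial>M)"
      by (rule real_cond_exp_intg(2)[symmetric])
         (auto intro: square_integrable_coordinate_mult X Y)
    also have "\<dots> = (\<integral>\<omega>. 0 \<partial>M)"
      using vec_cond_exp_zero_coordinate[OF centered b] measurable_from_subalg[OF subalg YF]
      by (intro integral_cong_AE) auto
    finally show "(\<integral>\<omega>. inner (Y \<omega>) b * inner (X \<omega>) b \<partial>M) = 0" by simp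
  qed simp
  finally show ?thesis by simp
qed

lemma cond_indep_centered_orthogonal:
  fixes X :: "'i \<Rightarrow> 'a \<Rightarrow> 'b::euclidean_space"
  assumes ind: "cond_indep_vars M F X I" and ij: "i \<in> I" "j \<in> I" "i \<noteq> j"
    and Xi: "square_integrable M (X i)" and Xj: "square_integrable M (X j)"
    and centered: "AE \<omega> in M. vec_cond_exp M F (X i) \<omega> = 0"
  shows "(\<integral>\<omega>. inner (X i \<omega>) (X j \<omega>) \<partial>M) = 0"
proof -
  have "(\<integral>\<omega>. inner (X i \<omega>) (X j \<omega>) \<partial>M) = (\<integral>\<omega>. (\<Sum>b\<in>Basis. inner (X i \<omega>) b * inner (X j \<omega>) b) \<partial>M)"
    by (rule Bochner_Integration.integral_cong[OF refl euclidean_inner])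
  also have "\<dots> = (\<Sum>b\<in>Basis. \<integral>\<omega>. inner (X i \<omega>) b * inner (X j \<omega>) b \<partial>M)"
    by (intro Bochner_Integration.integral_sum square_integrable_coordinate_mult Xi Xj)
  also have "\<dots> = (\<Sum>b\<in>(Basis :: 'b set). 0)"
    by (intro sum.cong cond_indep_centered_integral_mult[OF ind ij]
          square_integrable_coordinate square_integrable_coordinate_mult Xi Xj
          vec_cond_exp_zero_coordinate[OF centered]) auto
  finally show ?thesis by simp
qed

text \<open>Integrating the conditional bound gives square integrability as a conclusion: the nonnegative
  conditional expectation needs no integrability to be meaningful.\<close>

lemma conditional_second_moment:
  assumes [measurable]: "X \<in> borel_measurable M"
    and h: "integrable M h" "\<And>\<omega>. 0 \<le> h \<omega>"
    and bound: "AE \<omega> in M. nn_cond_exp M F (\<lambda>\<xi>. ennreal ((norm (X \<xi>))\<^sup>2)) \<omega> \<le> ennreal (h \<omega>)"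
  shows "square_integrable M X" and "(\<integral>\<omega>. (norm (X \<omega>))\<^sup>2 \<partial>M) \<le> (\<integral>\<omega>. h \<omega> \<partial>M)"
proof -
  have "(\<integral>\<^sup>+\<omega>. ennreal ((norm (X \<omega>))\<^sup>2) \<partial>M)
      = (\<integral>\<^sup>+\<omega>. 1 * nn_cond_exp M F (\<lambda>\<xi>. ennreal ((norm (X \<xi>))\<^sup>2)) \<omega> \<partial>M)"
    by (subst nn_cond_exp_intg) auto
  also have "\<dots> \<le> (\<integral>\<^sup>+\<omega>. ennreal (h \<omega>) \<partial>M)"
    using bound by (intro nn_integral_mono_AE) auto
  also have "\<dots> = ennreal (\<integral>\<omega>. h \<omega> \<partial>M)"
    using h by (intro nn_integral_eq_integral) auto
  finally have le: "(\<integral>\<^sup>+\<omega>. ennreal ((norm (X \<omega>))\<^sup>2) \<partial>M) \<le> ennreal (\<integral>\<omega>. h \<omega> \<partial>M)" .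
  have int: "integrable M (\<lambda>\<omega>. (norm (X \<omega>))\<^sup>2)"
    using le by (intro integrableI_nonneg) (auto intro: le_less_trans)
  then show "square_integrable M X" by (simp add: square_integrable_def)
  show "(\<integral>\<omega>. (norm (X \<omega>))\<^sup>2 \<partial>M) \<le> (\<integral>\<omega>. h \<omega> \<partial>M)"
    using le h(2) by (simp add: nn_integral_eq_integral[OF int] integral_nonneg ennreal_le_iff)
qed

end

section \<open>One step of averaged stochastic gradient descent\<close>

lemma integral_double_sum:
  fixes f :: "'i \<Rightarrow> 'j \<Rightarrow> 'w \<Rightarrow> real"
  assumes int: "\<And>i j. i \<in> A \<Longrightarrow> j \<in> B \<Longrightarrow> integrable M (f i j)"
  shows "(\<integral>\<omega>. (\<Sum>i\<in>A. \<Sum>j\<in>B. f i j \<omega>) \<partial>M) = (\<Sum>i\<in>A. \<Sum>j\<in>B. \<integral>\<omega>. f i j \<omega> \<partial>M)"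
proof -
  have "(\<integral>\<omega>. (\<Sum>i\<in>A. \<Sum>j\<in>B. f i j \<omega>) \<partial>M) = (\<Sum>i\<in>A. \<integral>\<omega>. (\<Sum>j\<in>B. f i j \<omega>) \<partial>M)"
    by (intro Bochner_Integration.integral_sum Bochner_Integration.integrable_sum int)
  also have "\<dots> = (\<Sum>i\<in>A. \<Sum>j\<in>B. \<integral>\<omega>. f i j \<omega> \<partial>M)"
    by (intro sum.cong refl Bochner_Integration.integral_sum int)
  finally show ?thesis .
qed

context smooth_strongly_convex
begin

lemma square_integrable_gradient:
  assumes "finite_measure M" "square_integrable M X"
  shows "square_integrable M (\<lambda>\<omega>. gradF (X \<omega>))"
proof (rule finite_measure.square_integrable_linear_growth[OF assms])
  show "norm (gradF x) \<le> norm (gradF 0) + L * norm x" for x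
    using norm_triangle_ineq[of "gradF 0" "gradF x - gradF 0"] gradient_lipschitz[of x 0] by simp
qed (use L_pos in auto)

lemma integrable_objective:
  assumes "finite_measure M" "square_integrable M X"
  shows "integrable M (\<lambda>\<omega>. F (X \<omega>))"
proof -
  interpret finite_measure M by fact
  note [measurable] = square_integrable_measurable[OF assms(2)]
  define B where "B = (\<lambda>x. \<bar>F 0\<bar> + \<bar>inner x (gradF 0)\<bar> + L / 2 * (norm x)\<^sup>2)"
  have "integrable M (\<lambda>\<omega>. B (X \<omega>))"
    unfolding B_def
    by (intro Bochner_Integration.integrable_add integrable_abs integrable_mult_right
          square_integrable_coordinate square_integrable_norm assms(2)) simp
  moreover have "\<bar>F x\<bar> \<le> \<bar>B x\<bar>" for x
  proof -
    have "0 \<le> L / 2 * (norm x)\<^sup>2" using L_pos by simp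
    then show ?thesis
      using quadratic_upper[of x 0] tangent_below[of 0 x]
      by (simp add: B_def inner_commute)
  qed
  ultimately show ?thesis
    by (simp add: Bochner_Integration.integrable_bound[of M "\<lambda>\<omega>. B (X \<omega>)"])
qed

end

text \<open>A single time step: \<open>X\<close> are the current positions, \<open>past\<close> is a sub-algebra that determines them, and \<open>g\<close>
  are the stochastic gradients drawn at these positions.\<close>

locale noisy_gradients = prob_space M + smooth_strongly_convex F gradF \<mu> L
  for M :: "'w measure" and F :: "'a::euclidean_space \<Rightarrow> real" and gradF \<mu> L +
  fixes past :: "'w measure" and n :: nat and c \<sigma> :: real and X g :: "nat \<Rightarrow> 'w \<Rightarrow> 'a"
  assumes past: "subalgebra M past" and workers: "n \<ge> 1" and c_nonneg: "c \<ge> 0"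
    and X_sq: "\<And>i. i \<in> {1..n} \<Longrightarrow> square_integrable M (X i)"
    and X_past: "\<And>i. i \<in> {1..n} \<Longrightarrow> X i \<in> borel_measurable past"
    and independent: "cond_indep_vars M past (\<lambda>i \<omega>. g i \<omega> - gradF (X i \<omega>)) {1..n}"
    and centered: "\<And>i. i \<in> {1..n} \<Longrightarrow>
      AE \<omega> in M. vec_cond_exp M past (\<lambda>\<omega>. g i \<omega> - gradF (X i \<omega>)) \<omega> = 0"
    and second_moment: "\<And>i. i \<in> {1..n} \<Longrightarrow>
      AE \<omega> in M. nn_cond_exp M past (\<lambda>\<xi>. ennreal ((norm (g i \<xi> - gradF (X i \<xi>)))\<^sup>2)) \<omega>
                   \<le> ennreal (c * (norm (gradF (X i \<omega>)))\<^sup>2 + \<sigma>\<^sup>2)"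
begin

sublocale past: finite_measure_subalgebra M past
  by unfold_locales (rule past)

definition noise :: "nat \<Rightarrow> 'w \<Rightarrow> 'a" where
  "noise i \<omega> = g i \<omega> - gradF (X i \<omega>)"

definition gradient_energy :: real where
  "gradient_energy = (\<Sum>i\<in>{1..n}. \<integral>\<omega>. (norm (gradF (X i \<omega>)))\<^sup>2 \<partial>M) / real n"

lemma gradient_sq: "i \<in> {1..n} \<Longrightarrow> square_integrable M (\<lambda>\<omega>. gradF (X i \<omega>))"
  by (intro square_integrable_gradient X_sq) unfold_locales

lemma noise_sq: "i \<in> {1..n} \<Longrightarrow> square_integrable M (noise i)"
  and noise_second_moment: "i \<in> {1..n} \<Longrightarrow>
    (\<integral>\<omega>. (norm (noise i \<omega>))\<^sup>2 \<partial>M) \<le> c * (\<integral>\<omega>. (norm (gradF (X i \<omega>)))\<^sup>2 \<partial>M) + \<sigma>\<^sup>2"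
proof -
  assume i: "i \<in> {1..n}"
  have meas: "noise i \<in> borel_measurable M"
    using independent i unfolding cond_indep_vars_def noise_def[abs_def] by auto
  have grad: "integrable M (\<lambda>\<omega>. (norm (gradF (X i \<omega>)))\<^sup>2)"
    using gradient_sq[OF i] by (rule square_integrable_norm)
  have bound: "integrable M (\<lambda>\<omega>. c * (norm (gradF (X i \<omega>)))\<^sup>2 + \<sigma>\<^sup>2)"
    using grad by simp
  have nonneg: "0 \<le> c * (norm (gradF (X i \<omega>)))\<^sup>2 + \<sigma>\<^sup>2" for \<omega>
    using c_nonneg by simp
  note moment = past.conditional_second_moment[OF meas bound nonneg
      second_moment[OF i, folded noise_def]]
  show "square_integrable M (noise i)" by (rule moment(1))
  have "(\<integral>\<omega>. c * (norm (gradF (X i \<omega>)))\<^sup>2 + \<sigma>\<^sup>2 \<partial>M)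
      = c * (\<integral>\<omega>. (norm (gradF (X i \<omega>)))\<^sup>2 \<partial>M) + \<sigma>\<^sup>2"
    using grad by (simp add: prob_space)
  then show "(\<integral>\<omega>. (norm (noise i \<omega>))\<^sup>2 \<partial>M)
      \<le> c * (\<integral>\<omega>. (norm (gradF (X i \<omega>)))\<^sup>2 \<partial>M) + \<sigma>\<^sup>2"
    using moment(2) by simp
qed

lemma stochastic_gradient_sq:
  assumes "i \<in> {1..n}"
  shows "square_integrable M (g i)"
proof -
  have "g i = (\<lambda>\<omega>. gradF (X i \<omega>) + noise i \<omega>)" by (simp add: noise_def fun_eq_iff)
  then show ?thesis
    using square_integrable_add[OF gradient_sq noise_sq] assms by metis
qed

lemma step_sq: "i \<in> {1..n} \<Longrightarrow> square_integrable M (\<lambda>\<omega>. X i \<omega> - h *\<^sub>R g i \<omega>)"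
  by (intro square_integrable_diff square_integrable_scaleR X_sq stochastic_gradient_sq)

lemma mean_sq:
  "(\<And>i. i \<in> {1..n} \<Longrightarrow> square_integrable M (Y i)) \<Longrightarrow> square_integrable M (\<lambda>\<omega>. mean n (\<lambda>i. Y i \<omega>))"
  unfolding mean_def by (intro square_integrable_scaleR square_integrable_sum)

lemma mean_past:
  fixes Y :: "nat \<Rightarrow> 'w \<Rightarrow> 'a"
  assumes "\<And>i. i \<in> {1..n} \<Longrightarrow> Y i \<in> borel_measurable past"
  shows "(\<lambda>\<omega>. mean n (\<lambda>i. Y i \<omega>)) \<in> borel_measurable past"
  unfolding mean_def by (rule borel_measurable_scaleR[OF borel_measurable_const borel_measurable_sum[OF assms]])

lemma gradient_past: "i \<in> {1..n} \<Longrightarrow> (\<lambda>\<omega>. gradF (X i \<omega>)) \<in> borel_measurable past"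
  using X_past by measurable

lemma noise_orthogonal_to_past:
  assumes "i \<in> {1..n}" "square_integrable M Y" "Y \<in> borel_measurable past"
  shows "(\<integral>\<omega>. inner (Y \<omega>) (noise i \<omega>) \<partial>M) = 0"
  using centered[OF assms(1), folded noise_def]
  by (intro past.centered_orthogonal_to_past assms noise_sq)

lemma noises_orthogonal:
  assumes "i \<in> {1..n}" "j \<in> {1..n}" "i \<noteq> j"
  shows "(\<integral>\<omega>. inner (noise i \<omega>) (noise j \<omega>) \<partial>M) = 0"
  using centered[OF assms(1), folded noise_def] independent[folded noise_def]
  by (intro past.cond_indep_centered_orthogonal[where I = "{1..n}" and X = noise] assms noise_sq) auto

lemma total_noise_le:
  "(\<Sum>i\<in>{1..n}. \<integral>\<omega>. (norm (noise i \<omega>))\<^sup>2 \<partial>M) \<le> real n * (c * gradient_energy + \<sigma>\<^sup>2)"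
proof -
  have "(\<Sum>i\<in>{1..n}. \<integral>\<omega>. (norm (noise i \<omega>))\<^sup>2 \<partial>M)
      \<le> (\<Sum>i\<in>{1..n}. c * (\<integral>\<omega>. (norm (gradF (X i \<omega>)))\<^sup>2 \<partial>M) + \<sigma>\<^sup>2)"
    by (intro sum_mono noise_second_moment)
  also have "\<dots> = real n * (c * gradient_energy + \<sigma>\<^sup>2)"
    using workers unfolding gradient_energy_def
    by (simp add: sum.distrib sum_distrib_left[symmetric] field_simps)
  finally show ?thesis .
qed

text \<open>The gain of a factor \<open>1 / n\<close> from parallel workers: the cross terms of the square vanish.\<close>

lemma mean_noise_second_moment:
  "(\<integral>\<omega>. (norm (mean n (\<lambda>i. noise i \<omega>)))\<^sup>2 \<partial>M) \<le> (c * gradient_energy + \<sigma>\<^sup>2) / real n"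
proof -
  have "(\<integral>\<omega>. (norm (mean n (\<lambda>i. noise i \<omega>)))\<^sup>2 \<partial>M)
      = (\<integral>\<omega>. (1 / real n)\<^sup>2 * (\<Sum>i\<in>{1..n}. \<Sum>j\<in>{1..n}. inner (noise i \<omega>) (noise j \<omega>)) \<partial>M)"
    by (intro Bochner_Integration.integral_cong refl)
       (simp only: mean_def power2_norm_eq_inner inner_scaleR_left inner_scaleR_right inner_sum_left,
        simp add: inner_sum_right power2_eq_square)
  also have "\<dots> = (1 / real n)\<^sup>2 * (\<integral>\<omega>. (\<Sum>i\<in>{1..n}. \<Sum>j\<in>{1..n}. inner (noise i \<omega>) (noise j \<omega>)) \<partial>M)"
    by (rule integral_mult_right_zero)
  also have "(\<integral>\<omega>. (\<Sum>i\<in>{1..n}. \<Sum>j\<in>{1..n}. inner (noise i \<omega>) (noise j \<omega>)) \<partial>M)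
      = (\<Sum>i\<in>{1..n}. \<Sum>j\<in>{1..n}. \<integral>\<omega>. inner (noise i \<omega>) (noise j \<omega>) \<partial>M)"
    by (intro integral_double_sum square_integrable_inner noise_sq)
  also have "\<dots> = (\<Sum>i\<in>{1..n}. \<Sum>j\<in>{1..n}. if i = j then \<integral>\<omega>. (norm (noise i \<omega>))\<^sup>2 \<partial>M else 0)"
    by (intro sum.cong refl) (auto simp: noises_orthogonal power2_norm_eq_inner)
  also have "\<dots> = (\<Sum>i\<in>{1..n}. \<integral>\<omega>. (norm (noise i \<omega>))\<^sup>2 \<partial>M)"
    by simp
  also have "(1 / real n)\<^sup>2 * \<dots> \<le> (1 / real n)\<^sup>2 * (real n * (c * gradient_energy + \<sigma>\<^sup>2))"
    by (intro mult_left_mono total_noise_le) simp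
  also have "\<dots> = (c * gradient_energy + \<sigma>\<^sup>2) / real n"
    using workers by (simp add: power2_eq_square)
  finally show ?thesis by simp
qed

text \<open>The difference of the two new points is the difference \<open>P\<close> of two exact gradient steps plus the
  difference of two noises. The noises are orthogonal to \<open>P\<close>, which the past determines, and to each
  other, so only squares survive.\<close>

lemma pair_distance_step:
  assumes ij: "i \<in> {1..n}" "j \<in> {1..n}" and h: "h \<ge> 0" "h * L \<le> 1"
  shows "(\<integral>\<omega>. (norm ((X i \<omega> - h *\<^sub>R g i \<omega>) - (X j \<omega> - h *\<^sub>R g j \<omega>)))\<^sup>2 \<partial>M)
      \<le> (1 - \<mu> * h) * (\<integral>\<omega>. (norm (X i \<omega> - X j \<omega>))\<^sup>2 \<partial>M)
        + h\<^sup>2 * ((\<integral>\<omega>. (norm (noise i \<omega>))\<^sup>2 \<partial>M) + (\<integral>\<omega>. (norm (noise j \<omega>))\<^sup>2 \<partial>M))"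
proof (cases "i = j")
  case True
  then show ?thesis by simp
next
  case False
  define P where "P = (\<lambda>\<omega>. (X i \<omega> - h *\<^sub>R gradF (X i \<omega>)) - (X j \<omega> - h *\<^sub>R gradF (X j \<omega>)))"
  have P_sq: "square_integrable M P"
    unfolding P_def by (intro square_integrable_diff square_integrable_scaleR X_sq gradient_sq ij)
  have P_past: "P \<in> borel_measurable past"
    unfolding P_def using X_past[OF ij(1)] X_past[OF ij(2)] gradient_past[OF ij(1)] gradient_past[OF ij(2)]
    by measurable
  note int = square_integrable_norm[OF P_sq] square_integrable_norm[OF noise_sq[OF ij(1)]]
    square_integrable_norm[OF noise_sq[OF ij(2)]]
    square_integrable_inner[OF P_sq noise_sq[OF ij(1)]]
    square_integrable_inner[OF P_sq noise_sq[OF ij(2)]]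
    square_integrable_inner[OF noise_sq[OF ij(1)] noise_sq[OF ij(2)]]
  have expand: "(norm ((X i \<omega> - h *\<^sub>R g i \<omega>) - (X j \<omega> - h *\<^sub>R g j \<omega>)))\<^sup>2
      = (norm (P \<omega>))\<^sup>2 - 2 * h * inner (P \<omega>) (noise i \<omega>) + 2 * h * inner (P \<omega>) (noise j \<omega>)
        + h\<^sup>2 * (norm (noise i \<omega>))\<^sup>2 + h\<^sup>2 * (norm (noise j \<omega>))\<^sup>2
        - 2 * h\<^sup>2 * inner (noise i \<omega>) (noise j \<omega>)" for \<omega>
  proof -
    have "(X i \<omega> - h *\<^sub>R g i \<omega>) - (X j \<omega> - h *\<^sub>R g j \<omega>) = P \<omega> - h *\<^sub>R (noise i \<omega> - noise j \<omega>)"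
      by (simp add: P_def noise_def algebra_simps)
    then show ?thesis
      by (simp only: power2_norm_eq_inner)
         (simp add: inner_commute power2_eq_square algebra_simps)
  qed
  have "(\<integral>\<omega>. (norm ((X i \<omega> - h *\<^sub>R g i \<omega>) - (X j \<omega> - h *\<^sub>R g j \<omega>)))\<^sup>2 \<partial>M)
      = (\<integral>\<omega>. (norm (P \<omega>))\<^sup>2 \<partial>M)
        + h\<^sup>2 * ((\<integral>\<omega>. (norm (noise i \<omega>))\<^sup>2 \<partial>M) + (\<integral>\<omega>. (norm (noise j \<omega>))\<^sup>2 \<partial>M))"
    unfolding expand
    using int noises_orthogonal[OF ij False]
      noise_orthogonal_to_past[OF ij(1) P_sq P_past] noise_orthogonal_to_past[OF ij(2) P_sq P_past]
    by (simp add: algebra_simps)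
  also have "(\<integral>\<omega>. (norm (P \<omega>))\<^sup>2 \<partial>M) \<le> (\<integral>\<omega>. (1 - \<mu> * h) * (norm (X i \<omega> - X j \<omega>))\<^sup>2 \<partial>M)"
  proof (rule integral_mono[OF int(1)])
    show "integrable M (\<lambda>\<omega>. (1 - \<mu> * h) * (norm (X i \<omega> - X j \<omega>))\<^sup>2)"
      using square_integrable_norm[OF square_integrable_diff[OF X_sq[OF ij(1)] X_sq[OF ij(2)]]] by simp
    show "(norm (P \<omega>))\<^sup>2 \<le> (1 - \<mu> * h) * (norm (X i \<omega> - X j \<omega>))\<^sup>2" for \<omega>
      unfolding P_def by (rule gradient_step_contracts[OF h])
  qed
  finally show ?thesis by simp
qed

lemma expected_spread:
  assumes "\<And>i. i \<in> {1..n} \<Longrightarrow> square_integrable M (Y i)"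
  shows "integrable M (\<lambda>\<omega>. spread n (\<lambda>i. Y i \<omega>))"
    and "(\<integral>\<omega>. spread n (\<lambda>i. Y i \<omega>) \<partial>M)
      = (\<Sum>i\<in>{1..n}. \<Sum>j\<in>{1..n}. \<integral>\<omega>. (norm (Y i \<omega> - Y j \<omega>))\<^sup>2 \<partial>M) / (2 * (real n)\<^sup>2)"
proof -
  have int: "integrable M (\<lambda>\<omega>. (norm (Y i \<omega> - Y j \<omega>))\<^sup>2)" if "i \<in> {1..n}" "j \<in> {1..n}" for i j
    using that assms by (intro square_integrable_norm square_integrable_diff)
  then show "integrable M (\<lambda>\<omega>. spread n (\<lambda>i. Y i \<omega>))"
    unfolding spread_def by (intro integrable_divide_zero Bochner_Integration.integrable_sum) auto
  show "(\<integral>\<omega>. spread n (\<lambda>i. Y i \<omega>) \<partial>M)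
      = (\<Sum>i\<in>{1..n}. \<Sum>j\<in>{1..n}. \<integral>\<omega>. (norm (Y i \<omega> - Y j \<omega>))\<^sup>2 \<partial>M) / (2 * (real n)\<^sup>2)"
    unfolding spread_def integral_divide_zero by (subst integral_double_sum) (auto intro: int)
qed

lemma expected_spread_step:
  assumes h: "h \<ge> 0" "h * L \<le> 1"
  shows "(\<integral>\<omega>. spread n (\<lambda>i. X i \<omega> - h *\<^sub>R g i \<omega>) \<partial>M)
      \<le> (1 - \<mu> * h) * (\<integral>\<omega>. spread n (\<lambda>i. X i \<omega>) \<partial>M) + h\<^sup>2 * (c * gradient_energy + \<sigma>\<^sup>2)"
proof -
  define N where "N = (\<lambda>i. \<integral>\<omega>. (norm (noise i \<omega>))\<^sup>2 \<partial>M)"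
  define D where "D = (\<lambda>i j. \<integral>\<omega>. (norm (X i \<omega> - X j \<omega>))\<^sup>2 \<partial>M)"
  have "(\<integral>\<omega>. spread n (\<lambda>i. X i \<omega> - h *\<^sub>R g i \<omega>) \<partial>M)
      = (\<Sum>i\<in>{1..n}. \<Sum>j\<in>{1..n}.
          \<integral>\<omega>. (norm ((X i \<omega> - h *\<^sub>R g i \<omega>) - (X j \<omega> - h *\<^sub>R g j \<omega>)))\<^sup>2 \<partial>M) / (2 * (real n)\<^sup>2)"
    by (rule expected_spread(2)) (rule step_sq)
  also have "\<dots> \<le> (\<Sum>i\<in>{1..n}. \<Sum>j\<in>{1..n}. (1 - \<mu> * h) * D i j + h\<^sup>2 * (N i + N j)) / (2 * (real n)\<^sup>2)"
    unfolding N_def D_def by (intro divide_right_mono sum_mono pair_distance_step h) auto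
  also have "(\<Sum>i\<in>{1..n}. \<Sum>j\<in>{1..n}. (1 - \<mu> * h) * D i j + h\<^sup>2 * (N i + N j))
      = (1 - \<mu> * h) * (\<Sum>i\<in>{1..n}. \<Sum>j\<in>{1..n}. D i j) + h\<^sup>2 * (2 * real n * (\<Sum>i\<in>{1..n}. N i))"
  proof -
    have "(\<Sum>i\<in>{1..n}. \<Sum>j\<in>{1..n}. N i + N j) = 2 * real n * (\<Sum>i\<in>{1..n}. N i)"
      by (simp add: sum.distrib sum_distrib_left[symmetric])
    moreover have "(\<Sum>i\<in>{1..n}. \<Sum>j\<in>{1..n}. (1 - \<mu> * h) * D i j + h\<^sup>2 * (N i + N j))
        = (1 - \<mu> * h) * (\<Sum>i\<in>{1..n}. \<Sum>j\<in>{1..n}. D i j) + h\<^sup>2 * (\<Sum>i\<in>{1..n}. \<Sum>j\<in>{1..n}. N i + N j)"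
      unfolding sum_distrib_left sum.distrib[symmetric] ..
    ultimately show ?thesis by simp
  qed
  also have "\<dots> / (2 * (real n)\<^sup>2)
      = (1 - \<mu> * h) * ((\<Sum>i\<in>{1..n}. \<Sum>j\<in>{1..n}. D i j) / (2 * (real n)\<^sup>2)) + h\<^sup>2 * ((\<Sum>i\<in>{1..n}. N i) / real n)"
    using workers by (simp add: add_divide_distrib power2_eq_square)
  also have "(\<Sum>i\<in>{1..n}. \<Sum>j\<in>{1..n}. D i j) / (2 * (real n)\<^sup>2) = (\<integral>\<omega>. spread n (\<lambda>i. X i \<omega>) \<partial>M)"
    unfolding D_def by (rule expected_spread(2)[symmetric]) (rule X_sq)
  also have "(1 - \<mu> * h) * (\<integral>\<omega>. spread n (\<lambda>i. X i \<omega>) \<partial>M) + h\<^sup>2 * ((\<Sum>i\<in>{1..n}. N i) / real n)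
      \<le> (1 - \<mu> * h) * (\<integral>\<omega>. spread n (\<lambda>i. X i \<omega>) \<partial>M) + h\<^sup>2 * (c * gradient_energy + \<sigma>\<^sup>2)"
  proof (intro add_left_mono mult_left_mono)
    show "(\<Sum>i\<in>{1..n}. N i) / real n \<le> c * gradient_energy + \<sigma>\<^sup>2"
      using total_noise_le workers by (simp add: N_def pos_divide_le_eq mult.commute)
  qed simp
  finally show ?thesis .
qed

lemma expected_descent:
  assumes h: "h \<ge> 0"
  shows "(\<integral>\<omega>. F (mean n (\<lambda>i. X i \<omega> - h *\<^sub>R g i \<omega>)) \<partial>M) - min_value F
      \<le> (1 - \<mu> * h) * ((\<integral>\<omega>. F (mean n (\<lambda>i. X i \<omega>)) \<partial>M) - min_value F)
        + (h * L\<^sup>2 / 2 * (\<integral>\<omega>. spread n (\<lambda>i. X i \<omega>) \<partial>M)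
           - h / 2 * (1 - L * h * (1 + c / real n)) * gradient_energy
           + L * h\<^sup>2 * \<sigma>\<^sup>2 / (2 * real n))"
proof -
  define z where "z = (\<lambda>\<omega>. mean n (\<lambda>i. X i \<omega>))"
  define m where "m = (\<lambda>\<omega>. mean n (\<lambda>i. gradF (X i \<omega>)))"
  define e where "e = (\<lambda>\<omega>. mean n (\<lambda>i. noise i \<omega>))"
  define \<gamma> where "\<gamma> = (\<lambda>\<omega>. (\<Sum>i\<in>{1..n}. (norm (gradF (X i \<omega>)))\<^sup>2) / real n)"
  define S where "S = (\<lambda>\<omega>. spread n (\<lambda>i. X i \<omega>))"
  have fin: "finite_measure M" by unfold_locales
  have z_sq: "square_integrable M z" unfolding z_def by (intro mean_sq X_sq)
  have m_sq: "square_integrable M m" unfolding m_def by (intro mean_sq gradient_sq)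
  have e_sq: "square_integrable M e" unfolding e_def by (intro mean_sq noise_sq)
  have gz_sq: "square_integrable M (\<lambda>\<omega>. gradF (z \<omega>))"
    by (rule square_integrable_gradient[OF fin z_sq])
  have m_past: "m \<in> borel_measurable past"
    unfolding m_def by (intro mean_past gradient_past)
  have z_past: "z \<in> borel_measurable past"
    unfolding z_def by (intro mean_past X_past)
  have gz_past: "(\<lambda>\<omega>. gradF (z \<omega>)) \<in> borel_measurable past"
    using z_past by measurable
  have orth: "(\<integral>\<omega>. inner (Y \<omega>) (e \<omega>) \<partial>M) = 0"
    if Y: "square_integrable M Y" "Y \<in> borel_measurable past" for Y
  proof -
    have "(\<integral>\<omega>. inner (Y \<omega>) (e \<omega>) \<partial>M) = (\<Sum>i\<in>{1..n}. \<integral>\<omega>. inner (Y \<omega>) (noise i \<omega>) \<partial>M) / real n"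
      unfolding e_def inner_mean
      by (simp add: Bochner_Integration.integral_sum square_integrable_inner noise_sq Y)
    then show ?thesis using noise_orthogonal_to_past Y by simp
  qed
  have int_\<gamma>: "integrable M \<gamma>"
    unfolding \<gamma>_def
    by (intro integrable_divide_zero Bochner_Integration.integrable_sum square_integrable_norm gradient_sq) auto
  have E_\<gamma>: "(\<integral>\<omega>. \<gamma> \<omega> \<partial>M) = gradient_energy"
    unfolding \<gamma>_def gradient_energy_def
    by (simp add: Bochner_Integration.integral_sum square_integrable_norm gradient_sq)
  have int_S: "integrable M S"
    unfolding S_def by (rule expected_spread(1)) (rule X_sq)
  have int_F: "integrable M (\<lambda>\<omega>. F (z \<omega>))"
    by (rule integrable_objective[OF fin z_sq])
  note int = int_\<gamma> int_S int_F square_integrable_inner[OF gz_sq e_sq]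
    square_integrable_inner[OF m_sq e_sq] square_integrable_norm[OF e_sq]
  define U where "U = (\<lambda>\<omega>. F (z \<omega>) - h * (\<mu> * (F (z \<omega>) - min_value F)) - h / 2 * \<gamma> \<omega>
        + h * L\<^sup>2 / 2 * S \<omega> - h * inner (gradF (z \<omega>)) (e \<omega>)
        + L * h\<^sup>2 / 2 * (\<gamma> \<omega> + 2 * inner (m \<omega>) (e \<omega>) + (norm (e \<omega>))\<^sup>2))"
  have int_U: "integrable M U"
    unfolding U_def using int by simp
  have new: "mean n (\<lambda>i. X i \<omega> - h *\<^sub>R g i \<omega>) = z \<omega> - h *\<^sub>R (m \<omega> + e \<omega>)" for \<omega>
  proof -
    have "mean n (\<lambda>i. X i \<omega> - h *\<^sub>R g i \<omega>)
        = mean n (\<lambda>i. X i \<omega> - (h *\<^sub>R gradF (X i \<omega>) + h *\<^sub>R noise i \<omega>))"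
      by (simp add: noise_def algebra_simps)
    also have "\<dots> = z \<omega> - h *\<^sub>R (m \<omega> + e \<omega>)"
      unfolding z_def m_def e_def mean_def
      by (simp add: sum_subtractf sum.distrib scaleR_sum_right[symmetric] algebra_simps)
    finally show ?thesis .
  qed
  have "(\<integral>\<omega>. F (mean n (\<lambda>i. X i \<omega> - h *\<^sub>R g i \<omega>)) \<partial>M) \<le> (\<integral>\<omega>. U \<omega> \<partial>M)"
  proof (rule integral_mono[OF _ int_U])
    show "integrable M (\<lambda>\<omega>. F (mean n (\<lambda>i. X i \<omega> - h *\<^sub>R g i \<omega>)))"
      by (intro integrable_objective[OF fin] mean_sq step_sq)
    show "F (mean n (\<lambda>i. X i \<omega> - h *\<^sub>R g i \<omega>)) \<le> U \<omega>" for \<omega>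
      unfolding new U_def \<gamma>_def S_def m_def z_def
      using workers h by (rule averaged_step_descent)
  qed
  also have "(\<integral>\<omega>. U \<omega> \<partial>M) = (\<integral>\<omega>. F (z \<omega>) \<partial>M) - h * (\<mu> * ((\<integral>\<omega>. F (z \<omega>) \<partial>M) - min_value F))
      - h / 2 * gradient_energy + h * L\<^sup>2 / 2 * (\<integral>\<omega>. S \<omega> \<partial>M)
      + L * h\<^sup>2 / 2 * (gradient_energy + (\<integral>\<omega>. (norm (e \<omega>))\<^sup>2 \<partial>M))"
    unfolding U_def using int E_\<gamma> orth[OF gz_sq gz_past] orth[OF m_sq m_past]
    by (simp add: prob_space)
  also have "\<dots> \<le> (\<integral>\<omega>. F (z \<omega>) \<partial>M) - h * (\<mu> * ((\<integral>\<omega>. F (z \<omega>) \<partial>M) - min_value F))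
      - h / 2 * gradient_energy + h * L\<^sup>2 / 2 * (\<integral>\<omega>. S \<omega> \<partial>M)
      + L * h\<^sup>2 / 2 * (gradient_energy + (c * gradient_energy + \<sigma>\<^sup>2) / real n)"
    using L_pos mean_noise_second_moment unfolding e_def
    by (intro add_left_mono mult_left_mono) auto
  finally show ?thesis
    using workers unfolding z_def S_def by (simp add: field_simps power2_eq_square)
qed

end

section \<open>The coupled recursion over growing communication intervals\<close>

text \<open>With \<open>u = t + \<beta>\<close> the contraction factor is \<open>1 - 2 / u\<close>, and \<open>u\<^sup>2 (1 - 2 / u) = (u - 1)\<^sup>2 - 1\<close> is at most the weight
  of the preceding step.\<close>

lemma weighted_recursion:
  fixes X D \<eta> :: "nat \<Rightarrow> real" and \<mu> \<beta> :: real
  assumes \<mu>: "\<mu> > 0" and \<beta>: "\<beta> \<ge> 1" and "p \<le> q"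
    and nonneg: "\<And>t. p \<le> t \<Longrightarrow> t < q \<Longrightarrow> 0 \<le> X t"
    and step: "\<And>t. p \<le> t \<Longrightarrow> t < q \<Longrightarrow> \<eta> t = 2 / (\<mu> * (real t + \<beta>))"
    and rec: "\<And>t. p \<le> t \<Longrightarrow> t < q \<Longrightarrow> X (Suc t) \<le> (1 - \<mu> * \<eta> t) * X t + D t"
  shows "(real q + \<beta> - 1)\<^sup>2 * X q
           \<le> (real p + \<beta> - 1)\<^sup>2 * X p + (\<Sum>t=p..<q. (real t + \<beta>)\<^sup>2 * D t)"
  using \<open>p \<le> q\<close> nonneg step rec
proof (induction q rule: dec_induct)
  case (step m)
  define u where "u = real m + \<beta>"
  have u: "u > 0" unfolding u_def using \<beta> by simp
  have \<eta>: "\<mu> * \<eta> m = 2 / u"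
    using step.prems(2)[of m] step.hyps \<mu> unfolding u_def by simp
  have "u\<^sup>2 * X (Suc m) \<le> u\<^sup>2 * ((1 - 2 / u) * X m + D m)"
    using step.prems(3)[of m] step.hyps \<eta> by (intro mult_left_mono) auto
  also have "\<dots> = (u\<^sup>2 - 2 * u) * X m + u\<^sup>2 * D m"
    using u by (simp add: field_simps power2_eq_square)
  also have "\<dots> \<le> (u - 1)\<^sup>2 * X m + u\<^sup>2 * D m"
    using step.prems(1)[of m] step.hyps
    by (intro add_right_mono mult_right_mono) (auto simp: power2_eq_square algebra_simps)
  also have "(u - 1)\<^sup>2 * X m \<le>
      (real p + \<beta> - 1)\<^sup>2 * X p + (\<Sum>t=p..<m. (real t + \<beta>)\<^sup>2 * D t)"
    unfolding u_def by (rule step.IH) (use step.prems in auto)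
  finally show ?case
    using step.hyps by (simp add: u_def)
qed simp

text \<open>Each term is at most \<open>ln (u / (u - 1))\<close> with \<open>u = t + \<beta>\<close>, and these telescope.\<close>

lemma sum_reciprocal_le_ln:
  fixes \<beta> :: real
  assumes "\<beta> > 0" "s < q"
  shows "(\<Sum>t\<in>{s<..<q}. 1 / (real t + \<beta>)) \<le> ln ((real q - 1 + \<beta>) / (real s + \<beta>))"
proof -
  have "Suc s \<le> q" using assms by simp
  then show ?thesis
  proof (induction q rule: dec_induct)
    case base
    have "{s<..<Suc s} = {}" by auto
    then show ?case using assms by simp
  next
    case (step m)
    have e: "{s<..<Suc m} = insert m {s<..<m}" using step.hyps by auto
    define u where "u = real m + \<beta>"
    have u: "u > 1" unfolding u_def using step.hyps assms by simp
    have "1 / u \<le> - ln (1 - 1 / u)"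
      using ln_le_minus_one[of "1 - 1 / u"] u by simp
    also have "\<dots> = ln (u / (u - 1))"
    proof -
      have "1 - 1 / u = (u - 1) / u" using u by (simp add: field_simps)
      then show ?thesis using u by (simp add: ln_div)
    qed
    finally have "1 / u \<le> ln (u / (u - 1))" .
    moreover have "ln ((real m - 1 + \<beta>) / (real s + \<beta>)) + ln (u / (u - 1)) = ln (u / (real s + \<beta>))"
    proof -
      have "real m - 1 + \<beta> = u - 1" by (simp add: u_def)
      then show ?thesis using u assms by (simp add: ln_div)
    qed
    ultimately show ?case
      using step.IH unfolding e by (simp add: u_def)
  qed
qed

lemma sum_triangle_swap:
  fixes f h :: "nat \<Rightarrow> 'b::comm_semiring_0"
  shows "(\<Sum>t=p..<q. h t * (\<Sum>s=p..<t. f s)) = (\<Sum>s=p..<q. f s * (\<Sum>t\<in>{s<..<q}. h t))"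
proof -
  have "(\<Sum>t=p..<q. h t * (\<Sum>s=p..<t. f s)) = (\<Sum>t=p..<q. \<Sum>s | s \<in> {p..<q} \<and> s < t. h t * f s)"
    unfolding sum_distrib_left by (intro sum.cong) auto
  also have "\<dots> = (\<Sum>s=p..<q. \<Sum>t | t \<in> {p..<q} \<and> s < t. h t * f s)"
    by (rule sum.swap_restrict) auto
  also have "\<dots> = (\<Sum>s=p..<q. f s * (\<Sum>t\<in>{s<..<q}. h t))"
    unfolding sum_distrib_left by (intro sum.cong) (auto simp: mult.commute)
  finally show ?thesis .
qed

text \<open>Solving the recursion from the communication at \<open>p\<close> gives \<open>(u - 1)\<^sup>2 V t \<le> (4 / \<mu>\<^sup>2) \<Sum> (c G s + \<sigma>\<^sup>2)\<close> with
  \<open>u = t + \<beta>\<close>. As \<open>u \<ge> 3\<close> for \<open>t > p\<close>, one has \<open>u / (u - 1)\<^sup>2 \<le> (9 / 4) / u\<close>, whence the constant \<open>9\<close>. The part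
  with \<open>G\<close> is then summed over \<open>t\<close> first, so that every \<open>G s\<close> is charged with the reciprocals of the later
  times of its interval only.\<close>

lemma block_spread_bound:
  fixes V G \<eta> :: "nat \<Rightarrow> real" and \<mu> \<beta> c \<sigma> K B :: real
  assumes \<mu>: "\<mu> > 0" and \<beta>: "\<beta> \<ge> 2" and c: "c \<ge> 0" and "p \<le> q"
    and V: "\<And>t. 0 \<le> V t" and G: "\<And>t. 0 \<le> G t"
    and start: "V p = 0"
    and step: "\<And>t. p \<le> t \<Longrightarrow> t < q \<Longrightarrow> \<eta> t = 2 / (\<mu> * (real t + \<beta>))"
    and rec: "\<And>t. p \<le> t \<Longrightarrow> Suc t < q \<Longrightarrow>
               V (Suc t) \<le> (1 - \<mu> * \<eta> t) * V t + (\<eta> t)\<^sup>2 * (c * G t + \<sigma>\<^sup>2)"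
    and recip: "\<And>s. p \<le> s \<Longrightarrow> s < q \<Longrightarrow> (\<Sum>t\<in>{s<..<q}. 1 / (real t + \<beta>)) \<le> K"
    and noise: "(\<Sum>t=p..<q. (real t - real p) / (real t + \<beta>)) \<le> B"
  shows "(\<Sum>t=p..<q. (real t + \<beta>) * V t)
           \<le> 9 / \<mu>\<^sup>2 * (c * K * (\<Sum>t=p..<q. G t) + B * \<sigma>\<^sup>2)"
proof -
  define N where "N = (\<lambda>s. c * G s + \<sigma>\<^sup>2)"
  have N: "0 \<le> N s" for s unfolding N_def using c G by simp
  have pointwise: "(real t + \<beta>) * V t \<le> 9 / \<mu>\<^sup>2 * (1 / (real t + \<beta>) * (\<Sum>s=p..<t. N s))"
    if t: "t \<in> {p..<q}" for t
  proof (cases "t = p")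
    case False
    define u where "u = real t + \<beta>"
    have u: "u \<ge> 3" unfolding u_def using False t \<beta> by simp
    have "(real t + \<beta> - 1)\<^sup>2 * V t
            \<le> (real p + \<beta> - 1)\<^sup>2 * V p + (\<Sum>s=p..<t. (real s + \<beta>)\<^sup>2 * ((\<eta> s)\<^sup>2 * N s))"
      by (rule weighted_recursion[OF \<mu>])
         (use \<beta> t V step rec in \<open>auto simp: N_def\<close>)
    also have "\<dots> = (\<Sum>s=p..<t. 4 / \<mu>\<^sup>2 * N s)"
      using start step t \<mu> \<beta>
      by (auto intro!: sum.cong simp: power_mult_distrib power_divide)
    also have "\<dots> = 4 / \<mu>\<^sup>2 * (\<Sum>s=p..<t. N s)"
      by (simp add: sum_distrib_left)
    finally have 1: "(u - 1)\<^sup>2 * V t \<le> 4 / \<mu>\<^sup>2 * (\<Sum>s=p..<t. N s)"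
      by (simp add: u_def)
    \<comment> \<open>For \<open>u \<ge> 3\<close> one has \<open>u - 1 \<ge> 2 u / 3\<close>.\<close>
    have "(2 / 3 * u)\<^sup>2 * V t \<le> (u - 1)\<^sup>2 * V t"
      using u V by (intro mult_right_mono power_mono) auto
    with 1 have "(2 / 3 * u)\<^sup>2 * V t \<le> 4 / \<mu>\<^sup>2 * (\<Sum>s=p..<t. N s)"
      by simp
    then have "9 / (4 * u) * ((2 / 3 * u)\<^sup>2 * V t) \<le> 9 / (4 * u) * (4 / \<mu>\<^sup>2 * (\<Sum>s=p..<t. N s))"
      using u by (intro mult_left_mono) auto
    moreover have "9 / (4 * u) * ((2 / 3 * u)\<^sup>2 * V t) = u * V t"
      using u by (simp add: field_simps power2_eq_square)
    moreover have "9 / (4 * u) * (4 / \<mu>\<^sup>2 * (\<Sum>s=p..<t. N s)) = 9 / \<mu>\<^sup>2 * (1 / u * (\<Sum>s=p..<t. N s))"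
      by simp
    ultimately show ?thesis
      unfolding u_def by linarith
  qed (use start in simp)
  have "(\<Sum>t=p..<q. 1 / (real t + \<beta>) * (\<Sum>s=p..<t. N s))
      = (\<Sum>t=p..<q. 1 / (real t + \<beta>) * (\<Sum>s=p..<t. c * G s))
        + \<sigma>\<^sup>2 * (\<Sum>t=p..<q. (real t - real p) / (real t + \<beta>))"
  proof -
    have "1 / (real t + \<beta>) * (\<Sum>s=p..<t. N s)
        = 1 / (real t + \<beta>) * (\<Sum>s=p..<t. c * G s) + \<sigma>\<^sup>2 * ((real t - real p) / (real t + \<beta>))"
      if "t \<in> {p..<q}" for t
      using that unfolding N_def sum.distrib by (simp add: of_nat_diff ring_distribs diff_divide_distrib mult.commute)
    then show ?thesis
      by (simp add: sum.distrib sum_distrib_left)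
  qed
  also have "(\<Sum>t=p..<q. 1 / (real t + \<beta>) * (\<Sum>s=p..<t. c * G s))
      = (\<Sum>s=p..<q. c * G s * (\<Sum>t\<in>{s<..<q}. 1 / (real t + \<beta>)))"
    by (rule sum_triangle_swap)
  also have "\<dots> \<le> (\<Sum>s=p..<q. c * G s * K)"
    using recip c G by (intro sum_mono mult_left_mono) auto
  also have "\<dots> = c * K * (\<Sum>s=p..<q. G s)"
    by (simp add: sum_distrib_left mult_ac)
  also have "\<sigma>\<^sup>2 * (\<Sum>t=p..<q. (real t - real p) / (real t + \<beta>)) \<le> B * \<sigma>\<^sup>2"
    by (metis mult.commute mult_left_mono noise zero_le_power2)
  finally have bound: "(\<Sum>t=p..<q. 1 / (real t + \<beta>) * (\<Sum>s=p..<t. N s))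
      \<le> c * K * (\<Sum>s=p..<q. G s) + B * \<sigma>\<^sup>2"
    by simp
  have "(\<Sum>t=p..<q. (real t + \<beta>) * V t)
      \<le> (\<Sum>t=p..<q. 9 / \<mu>\<^sup>2 * (1 / (real t + \<beta>) * (\<Sum>s=p..<t. N s)))"
    by (rule sum_mono) (rule pointwise)
  also have "\<dots> = 9 / \<mu>\<^sup>2 * (\<Sum>t=p..<q. 1 / (real t + \<beta>) * (\<Sum>s=p..<t. N s))"
    by (simp add: sum_distrib_left)
  also have "\<dots> \<le> 9 / \<mu>\<^sup>2 * (c * K * (\<Sum>s=p..<q. G s) + B * \<sigma>\<^sup>2)"
    by (intro mult_left_mono bound) simp
  finally show ?thesis .
qed

lemma sum_offsets_le:
  fixes p q :: nat
  assumes "p \<le> q"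
  shows "(\<Sum>t=p..<q. real t - real p) \<le> (real q - real p)\<^sup>2 / 2"
  using assms
proof (induction q rule: dec_induct)
  case (step m)
  have "(real (Suc m) - real p)\<^sup>2 = (real m - real p)\<^sup>2 + 2 * (real m - real p) + 1"
    by (simp add: power2_eq_square algebra_simps)
  then show ?case using step by simp
qed simp

text \<open>The communication times are triangular numbers times \<open>a\<close>, cut off at \<open>T\<close>; doubling avoids a division.\<close>

lemma double_comm_time:
  assumes "\<And>i. H i = a * (i + 1)"
  shows "2 * comm_time H T i = min (a * i * (i + 1)) (2 * T)"
proof (induction i)
  case (Suc i)
  define P Q where "P = a * i * (i + 1)" and "Q = a * (i + 1)"
  have "a * Suc i * (Suc i + 1) = P + 2 * Q"
    unfolding P_def Q_def by (simp add: algebra_simps)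
  moreover have "2 * comm_time H T i = min P (2 * T)" "H i = Q"
    using Suc assms[of i] by (simp_all add: P_def Q_def)
  ultimately show ?case
    by (simp add: min_def split: if_splits)
qed simp

lemma comm_time_le_Suc: "comm_time H T i \<le> comm_time H T (Suc i)"
proof -
  have "comm_time H T i \<le> T" by (cases i) auto
  then show ?thesis by simp
qed

lemma sum_blocks:
  fixes f :: "nat \<Rightarrow> 'b::comm_monoid_add"
  shows "(\<Sum>i<R. \<Sum>t=comm_time H T i..<comm_time H T (Suc i). f t) = (\<Sum>t<comm_time H T R. f t)"
proof (induction R)
  case (Suc R)
  show ?case
    unfolding sum.lessThan_Suc Suc.IH unfolding lessThan_atLeast0
    by (rule sum.atLeastLessThan_concat[OF le0 comm_time_le_Suc])
qed simp

lemma between_comm_times: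
  assumes "\<I> = comm_time H T ` {1..R}" "i < R"
    and "comm_time H T i \<le> t" "Suc t < comm_time H T (Suc i)"
  shows "Suc t \<notin> \<I>"
proof
  have mono: "mono (comm_time H T)"
    using comm_time_le_Suc by (auto simp: mono_iff_le_Suc)
  assume "Suc t \<in> \<I>"
  then obtain j where j: "Suc t = comm_time H T j"
    using assms by auto
  show False
  proof (cases "j \<le> i")
    case True
    then show ?thesis using monoD[OF mono True] j assms by simp
  next
    case False
    then have "Suc i \<le> j" by simp
    then show ?thesis using monoD[OF mono, of "Suc i" j] j assms by linarith
  qed
qed

context
  fixes T R a :: nat and H :: "nat \<Rightarrow> nat" and \<kappa> \<beta> :: real
  assumes R: "1 \<le> R" and a_def: "a = nat \<lceil>2 * real T / (real R)\<^sup>2\<rceil>"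
    and H: "\<And>i. H i = a * (i + 1)"
    and \<kappa>: "\<kappa> \<ge> 1" and \<beta>: "\<beta> \<ge> 2 * \<kappa>\<^sup>2"
begin

lemma beta_ge_2: "\<beta> \<ge> 2"
  using \<kappa> \<beta> one_le_power[of \<kappa> 2] by linarith

lemma a_lower: "2 * real T / (real R)\<^sup>2 \<le> real a"
  and a_upper: "real a < 2 * real T / (real R)\<^sup>2 + 1"
proof -
  have "0 \<le> 2 * real T / (real R)\<^sup>2" by simp
  then have "real a = of_int \<lceil>2 * real T / (real R)\<^sup>2\<rceil>"
    unfolding a_def by simp
  then show "2 * real T / (real R)\<^sup>2 \<le> real a" "real a < 2 * real T / (real R)\<^sup>2 + 1"
    by linarith+
qed

text \<open>The schedule reaches the horizon, so the \<open>R\<close> intervals cover all iterations: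
  \<open>a R (R + 1) / 2 \<ge> a R\<^sup>2 / 2 \<ge> T\<close>.\<close>

lemma comm_time_R: "comm_time H T R = T"
proof -
  have "2 * real T \<le> real a * (real R)\<^sup>2"
    using a_lower R by (simp add: field_simps)
  also have "\<dots> \<le> real a * (real R * (real R + 1))"
    by (simp add: power2_eq_square mult_left_mono)
  finally have "real (2 * T) \<le> real (a * R * (R + 1))"
    by (simp add: algebra_simps)
  then have "2 * T \<le> a * R * (R + 1)"
    by (simp only: of_nat_le_iff)
  then have "min (a * R * (R + 1)) (2 * T) = 2 * T"
    by (rule min_absorb2)
  then show ?thesis
    using double_comm_time[of H a T R, OF H] by linarith
qed

lemma comm_time_block:
  assumes "comm_time H T i < comm_time H T (Suc i)"
  shows "2 * comm_time H T i = a * i * (i + 1)"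
    and "comm_time H T (Suc i) \<le> comm_time H T i + a * (i + 1)"
proof -
  have "comm_time H T i < T"
    using assms by (cases "comm_time H T i < T") auto
  then show "2 * comm_time H T i = a * i * (i + 1)"
    using double_comm_time[of H a T i, OF H] by linarith
  show "comm_time H T (Suc i) \<le> comm_time H T i + a * (i + 1)"
    using H by simp
qed

text \<open>The sum is at most the logarithm of the ratio of the last time of the interval to its start, both
  shifted by \<open>\<beta>\<close>. The first interval has length at most \<open>2 T / R\<^sup>2 + 1\<close> and starts at the shift \<open>\<beta> \<ge> 2 \<kappa>\<^sup>2\<close>; a
  later one at most triples the time, because \<open>a (i + 1) \<le> a i (i + 1)\<close>, which is twice its start. These
  are the two logarithms.\<close>

lemma block_reciprocal_bound:
  assumes s: "comm_time H T i \<le> s" "s < comm_time H T (Suc i)"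
  shows "(\<Sum>t\<in>{s<..<comm_time H T (Suc i)}. 1 / (real t + \<beta>))
           \<le> max (ln 3) (ln (1 + real T / ((real R)\<^sup>2 * \<kappa>\<^sup>2)))"
proof -
  define p q where "p = comm_time H T i" and "q = comm_time H T (Suc i)"
  have pq: "p \<le> s" "s < q" using s by (simp_all add: p_def q_def)
  have blk: "2 * p = a * i * (i + 1)" "q \<le> p + a * (i + 1)"
    using comm_time_block[of i] s by (simp_all add: p_def q_def)
  have b: "\<beta> > 0" using beta_ge_2 by simp
  have "(\<Sum>t\<in>{s<..<q}. 1 / (real t + \<beta>)) \<le> ln ((real q - 1 + \<beta>) / (real s + \<beta>))"
    by (rule sum_reciprocal_le_ln) (use b pq in auto)
  also have "\<dots> \<le> ln ((real q - 1 + \<beta>) / (real p + \<beta>))"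
    using b pq by (intro ln_mono divide_left_mono) (auto intro!: mult_pos_pos divide_pos_pos)
  also have "\<dots> \<le> max (ln 3) (ln (1 + real T / ((real R)\<^sup>2 * \<kappa>\<^sup>2)))"
  proof (cases "i = 0")
    case True
    have p0: "p = 0" using True by (simp add: p_def)
    have "real q - 1 \<le> 2 * real T / (real R)\<^sup>2"
      using blk(2) a_upper True p0 by simp
    then have "(real q - 1 + \<beta>) / \<beta> \<le> (2 * real T / (real R)\<^sup>2 + \<beta>) / \<beta>"
      using b by (intro divide_right_mono) auto
    also have "\<dots> = 1 + (2 * real T / (real R)\<^sup>2) / \<beta>"
      using b by (simp add: field_simps)
    also have "(2 * real T / (real R)\<^sup>2) / \<beta> \<le> (2 * real T / (real R)\<^sup>2) / (2 * \<kappa>\<^sup>2)"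
      using \<beta> b \<kappa> by (intro divide_left_mono) auto
    also have "\<dots> = real T / ((real R)\<^sup>2 * \<kappa>\<^sup>2)"
      by simp
    finally have "ln ((real q - 1 + \<beta>) / (real p + \<beta>)) \<le> ln (1 + real T / ((real R)\<^sup>2 * \<kappa>\<^sup>2))"
      using b pq p0 by (intro ln_mono) (auto intro!: divide_pos_pos)
    then show ?thesis by linarith
  next
    case False
    have "a * (i + 1) * 1 \<le> a * (i + 1) * i"
      using False by (intro mult_left_mono) auto
    then have "a * (i + 1) \<le> 2 * p"
      using blk(1) by (simp only: mult_ac)
    then have "q \<le> 3 * p" using blk(2) by linarith
    then have "real q \<le> 3 * real p" by linarith
    then have "(real q - 1 + \<beta>) / (real p + \<beta>) \<le> 3"
      using b by (simp add: field_simps)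
    then have "ln ((real q - 1 + \<beta>) / (real p + \<beta>)) \<le> ln 3"
      using b pq by (intro ln_mono) (auto intro!: divide_pos_pos)
    then show ?thesis by linarith
  qed
  finally show ?thesis by (simp add: q_def)
qed

text \<open>For \<open>i \<ge> 1\<close> the sum is at most the squared length \<open>a\<^sup>2 (i + 1)\<^sup>2\<close> over twice the start \<open>a i (i + 1) / 2\<close>, which
  is \<open>a (i + 1) / i\<close>. Interval lengths growing linearly are exactly what makes this uniform in \<open>i\<close>.\<close>

lemma block_noise_bound:
  "(\<Sum>t=comm_time H T i..<comm_time H T (Suc i). (real t - real (comm_time H T i)) / (real t + \<beta>))
     \<le> 2 * real a"
proof (cases "comm_time H T i < comm_time H T (Suc i)")
  case True
  define p q where "p = comm_time H T i" and "q = comm_time H T (Suc i)"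
  have pq: "p < q" using True by (simp add: p_def q_def)
  have blk: "2 * p = a * i * (i + 1)" "q \<le> p + a * (i + 1)"
    using comm_time_block[of i] True by (simp_all add: p_def q_def)
  have b: "\<beta> > 0" using beta_ge_2 by simp
  have "(\<Sum>t=p..<q. (real t - real p) / (real t + \<beta>)) \<le> 2 * real a"
  proof (cases "i = 0")
    case True
    have "(\<Sum>t=p..<q. (real t - real p) / (real t + \<beta>)) \<le> (\<Sum>t=p..<q. 1)"
      using b by (intro sum_mono) (auto simp: field_simps)
    then have "(\<Sum>t=p..<q. (real t - real p) / (real t + \<beta>)) \<le> real (q - p)"
      by simp
    moreover have "q - p \<le> a" using blk True by simp
    ultimately show ?thesis by simp
  next
    case False
    have "a > 0" using blk(2) pq by (cases a) auto
    then have p: "p > 0" using blk(1) False by (cases p) auto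
    have "(\<Sum>t=p..<q. (real t - real p) / (real t + \<beta>)) \<le> (\<Sum>t=p..<q. (real t - real p) / real p)"
      using b p by (intro sum_mono divide_left_mono) auto
    also have "\<dots> = (\<Sum>t=p..<q. real t - real p) / real p"
      by (simp add: sum_divide_distrib)
    also have "\<dots> \<le> ((real q - real p)\<^sup>2 / 2) / real p"
      using pq by (intro divide_right_mono sum_offsets_le) auto
    also have "\<dots> \<le> ((real a * (real i + 1))\<^sup>2 / 2) / real p"
    proof -
      have "real q \<le> real (p + a * (i + 1))" using blk(2) by (simp only: of_nat_le_iff)
      then show ?thesis
        using pq by (intro divide_right_mono power_mono) (auto simp: algebra_simps)
    qed
    also have "\<dots> = real a * ((real i + 1) / real i)"
    proof -
      have "2 * real p = real a * real i * (real i + 1)"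
        using arg_cong[OF blk(1), of real] by (simp add: algebra_simps)
      then have e: "real p = real a * real i * (real i + 1) / 2" by simp
      have i1: "real i + 1 > 0" by simp
      show ?thesis
        unfolding e using False \<open>a > 0\<close> i1
        by (simp add: divide_simps power2_eq_square del: of_nat_Suc)
    qed
    also have "\<dots> \<le> real a * 2"
      using False by (intro mult_left_mono) (auto simp: field_simps)
    finally show ?thesis by simp
  qed
  then show ?thesis by (simp add: p_def q_def)
next
  case False
  then have "{comm_time H T i..<comm_time H T (Suc i)} = {}"
    by (simp del: comm_time.simps)
  then show ?thesis by (simp only: sum.empty)
qed

text \<open>The weights turn the descent inequality into a telescoping sum in which \<open>V\<close> appears with weight \<open>t + \<beta>\<close>,
  as bounded interval by interval above, and \<open>G\<close> with the negative weight \<open>t + \<beta> - 2 \<kappa> (1 + c / m)\<close> up to the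
  factor \<open>1 / \<mu>\<close>. The lower bound on \<open>\<beta>\<close> makes the latter outweigh the contribution of \<open>G\<close> through \<open>V\<close>.
  The positive real \<open>m\<close> stands for the number of workers.\<close>

lemma recursion_solution:
  fixes \<xi> V G \<eta> :: "nat \<Rightarrow> real" and \<mu> L c \<sigma> m :: real and \<I> :: "nat set"
  assumes \<mu>: "\<mu> > 0" and \<kappa>_def: "\<kappa> = L / \<mu>"
    and T: "T \<ge> 1" and R_le: "real R \<le> sqrt (2 * real T)" and c: "c \<ge> 0" and m: "m > 0"
    and \<I>: "\<I> = comm_time H T ` {1..R}"
    and large: "\<beta> \<ge> 9 * \<kappa>\<^sup>2 * c * max (ln 3) (ln (1 + real T / ((real R)\<^sup>2 * \<kappa>\<^sup>2)))
                     + 2 * \<kappa> * (1 + c / m)"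
    and step: "\<And>t. t < T \<Longrightarrow> \<eta> t = 2 / (\<mu> * (real t + \<beta>))"
    and nonneg: "\<And>t. t \<le> T \<Longrightarrow> 0 \<le> \<xi> t" "\<And>t. 0 \<le> V t" "\<And>t. 0 \<le> G t"
    and sync: "V 0 = 0" "\<And>t. t \<in> \<I> \<Longrightarrow> V t = 0"
    and spread: "\<And>t. t < T \<Longrightarrow> Suc t \<notin> \<I> \<Longrightarrow>
                   V (Suc t) \<le> (1 - \<mu> * \<eta> t) * V t + (\<eta> t)\<^sup>2 * (c * G t + \<sigma>\<^sup>2)"
    and descent: "\<And>t. t < T \<Longrightarrow>
                   \<xi> (Suc t) \<le> (1 - \<mu> * \<eta> t) * \<xi> t + (\<eta> t * L\<^sup>2 / 2 * V t
                     - \<eta> t / 2 * (1 - L * \<eta> t * (1 + c / m)) * G t + L * (\<eta> t)\<^sup>2 * \<sigma>\<^sup>2 / (2 * m))"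
  shows "\<xi> T \<le> \<beta>\<^sup>2 * \<xi> 0 / (real T)\<^sup>2 + 2 * L * \<sigma>\<^sup>2 / (m * \<mu>\<^sup>2 * real T)
                + 72 * L\<^sup>2 * \<sigma>\<^sup>2 / (\<mu>^3 * real T * real R)"
proof -
  define K where "K = max (ln 3) (ln (1 + real T / ((real R)\<^sup>2 * \<kappa>\<^sup>2)))"
  define SG SV where "SG = (\<Sum>t<T. G t)" and "SV = (\<Sum>t<T. (real t + \<beta>) * V t)"
  have SG: "SG \<ge> 0" unfolding SG_def by (intro sum_nonneg nonneg)
  have "SV \<le> (\<Sum>i<R. 9 / \<mu>\<^sup>2 * (c * K * (\<Sum>t=comm_time H T i..<comm_time H T (Suc i). G t)
                          + 2 * real a * \<sigma>\<^sup>2))"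
    unfolding SV_def sum_blocks[of _ H T R, unfolded comm_time_R, symmetric]
  proof (rule sum_mono)
    fix i assume "i \<in> {..<R}"
    then have i: "i < R" by simp
    have le_T: "comm_time H T j \<le> T" for j by (cases j) auto
    have below: "t < T" if "t < comm_time H T (Suc i)" for t
      using that le_T[of "Suc i"] by simp
    have start: "V (comm_time H T i) = 0"
    proof (cases "i = 0")
      case False
      then show ?thesis using i by (intro sync(2)) (auto simp: \<I>)
    qed (use sync in simp)
    have recip: "(\<Sum>t\<in>{s<..<comm_time H T (Suc i)}. 1 / (real t + \<beta>)) \<le> K"
      if "comm_time H T i \<le> s" "s < comm_time H T (Suc i)" for s
      unfolding K_def using that by (rule block_reciprocal_bound)
    have rec: "V (Suc t) \<le> (1 - \<mu> * \<eta> t) * V t + (\<eta> t)\<^sup>2 * (c * G t + \<sigma>\<^sup>2)"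
      if "comm_time H T i \<le> t" "Suc t < comm_time H T (Suc i)" for t
      using that below[of t] between_comm_times[OF \<I> i that] by (intro spread) auto
    show "(\<Sum>t=comm_time H T i..<comm_time H T (Suc i). (real t + \<beta>) * V t)
        \<le> 9 / \<mu>\<^sup>2 * (c * K * (\<Sum>t=comm_time H T i..<comm_time H T (Suc i). G t)
                     + 2 * real a * \<sigma>\<^sup>2)"
      using below by (intro block_spread_bound[where \<eta> = \<eta>] \<mu> beta_ge_2 c comm_time_le_Suc
          nonneg start step rec recip block_noise_bound)
  qed
  also have "\<dots> = 9 / \<mu>\<^sup>2 * (c * K * SG + real R * (2 * real a * \<sigma>\<^sup>2))"
    unfolding SG_def sum_blocks[of _ H T R, unfolded comm_time_R, symmetric]
    by (simp only: sum_distrib_left[symmetric] sum.distrib sum_constant card_lessThan)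
       (simp add: mult_ac)
  finally have "L\<^sup>2 / \<mu> * SV \<le> L\<^sup>2 / \<mu> * (9 / \<mu>\<^sup>2 * (c * K * SG + real R * (2 * real a * \<sigma>\<^sup>2)))"
    using \<mu> by (intro mult_left_mono) auto
  also have "\<dots> = 9 * \<kappa>\<^sup>2 * c * K / \<mu> * SG + 9 * L\<^sup>2 * \<sigma>\<^sup>2 / \<mu>^3 * (2 * real a * real R)"
    unfolding \<kappa>_def using \<mu> by (simp add: field_simps power2_eq_square power3_eq_cube)
  finally have SV: "L\<^sup>2 / \<mu> * SV
      \<le> 9 * \<kappa>\<^sup>2 * c * K / \<mu> * SG + 9 * L\<^sup>2 * \<sigma>\<^sup>2 / \<mu>^3 * (2 * real a * real R)" .

  define D where "D = (\<lambda>t. \<eta> t * L\<^sup>2 / 2 * V t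
     - \<eta> t / 2 * (1 - L * \<eta> t * (1 + c / m)) * G t + L * (\<eta> t)\<^sup>2 * \<sigma>\<^sup>2 / (2 * m))"
  \<comment> \<open>The coefficient of \<open>G t\<close> is where the lower bound on \<open>\<beta>\<close> is spent.\<close>
  have D_le: "(real t + \<beta>)\<^sup>2 * D t
      \<le> L\<^sup>2 / \<mu> * ((real t + \<beta>) * V t) - 9 * \<kappa>\<^sup>2 * c * K / \<mu> * G t + 2 * L * \<sigma>\<^sup>2 / (m * \<mu>\<^sup>2)"
    if t: "t < T" for t
  proof -
    define u where "u = real t + \<beta>"
    have u: "u > 0" using beta_ge_2 by (simp add: u_def)
    have \<eta>: "\<eta> t = 2 / (\<mu> * u)" using step[OF t] by (simp add: u_def)
    have "u\<^sup>2 * D t = u\<^sup>2 * (\<eta> t * L\<^sup>2 / 2 * V t)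
        - u\<^sup>2 * (\<eta> t / 2 * (1 - L * \<eta> t * (1 + c / m))) * G t + u\<^sup>2 * (L * (\<eta> t)\<^sup>2 * \<sigma>\<^sup>2 / (2 * m))"
      unfolding D_def by (simp add: algebra_simps)
    also have "u\<^sup>2 * (\<eta> t * L\<^sup>2 / 2 * V t) = L\<^sup>2 / \<mu> * (u * V t)"
      unfolding \<eta> using u \<mu> by (simp add: field_simps power2_eq_square)
    also have "u\<^sup>2 * (L * (\<eta> t)\<^sup>2 * \<sigma>\<^sup>2 / (2 * m)) = 2 * L * \<sigma>\<^sup>2 / (m * \<mu>\<^sup>2)"
      unfolding \<eta> using u \<mu> m by (simp add: field_simps power2_eq_square)
    also have "u\<^sup>2 * (\<eta> t / 2 * (1 - L * \<eta> t * (1 + c / m))) = (u - 2 * \<kappa> * (1 + c / m)) / \<mu>"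
      unfolding \<eta> \<kappa>_def using u \<mu> m by (simp add: field_simps power2_eq_square)
    finally have 1: "u\<^sup>2 * D t = L\<^sup>2 / \<mu> * (u * V t) - (u - 2 * \<kappa> * (1 + c / m)) / \<mu> * G t
                        + 2 * L * \<sigma>\<^sup>2 / (m * \<mu>\<^sup>2)" .
    have "9 * \<kappa>\<^sup>2 * c * K \<le> u - 2 * \<kappa> * (1 + c / m)"
      using large by (simp add: K_def u_def)
    then have "9 * \<kappa>\<^sup>2 * c * K / \<mu> * G t \<le> (u - 2 * \<kappa> * (1 + c / m)) / \<mu> * G t"
      using \<mu> nonneg by (intro mult_right_mono divide_right_mono) auto
    with 1 show ?thesis by (simp add: u_def)
  qed
  have descent_D: "\<xi> (Suc t) \<le> (1 - \<mu> * \<eta> t) * \<xi> t + D t" if "t < T" for t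
    using descent[OF that] unfolding D_def .
  have "(real T + \<beta> - 1)\<^sup>2 * \<xi> T \<le> (real 0 + \<beta> - 1)\<^sup>2 * \<xi> 0 + (\<Sum>t=0..<T. (real t + \<beta>)\<^sup>2 * D t)"
    by (rule weighted_recursion[OF \<mu>, where \<eta> = \<eta>])
       (use beta_ge_2 nonneg step descent_D in auto)
  also have "(real 0 + \<beta> - 1)\<^sup>2 * \<xi> 0 \<le> \<beta>\<^sup>2 * \<xi> 0"
    using beta_ge_2 nonneg by (intro mult_right_mono power_mono) auto
  also have "(\<Sum>t=0..<T. (real t + \<beta>)\<^sup>2 * D t)
      \<le> (\<Sum>t=0..<T. L\<^sup>2 / \<mu> * ((real t + \<beta>) * V t) - 9 * \<kappa>\<^sup>2 * c * K / \<mu> * G t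
                     + 2 * L * \<sigma>\<^sup>2 / (m * \<mu>\<^sup>2))"
    by (rule sum_mono) (use D_le in auto)
  also have "\<dots> = L\<^sup>2 / \<mu> * SV - 9 * \<kappa>\<^sup>2 * c * K / \<mu> * SG + real T * (2 * L * \<sigma>\<^sup>2 / (m * \<mu>\<^sup>2))"
    unfolding SV_def SG_def lessThan_atLeast0 sum_distrib_left
    by (simp add: sum.distrib sum_subtractf)
  also have "\<dots> \<le> 9 * L\<^sup>2 * \<sigma>\<^sup>2 / \<mu>^3 * (2 * real a * real R) + real T * (2 * L * \<sigma>\<^sup>2 / (m * \<mu>\<^sup>2))"
    using SV by simp
  also have "\<dots> \<le> 9 * L\<^sup>2 * \<sigma>\<^sup>2 / \<mu>^3 * (8 * real T / real R) + real T * (2 * L * \<sigma>\<^sup>2 / (m * \<mu>\<^sup>2))"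
  proof -
    \<comment> \<open>The bound on \<open>R\<close> makes \<open>2 T / R\<^sup>2\<close> at least \<open>1\<close>, so rounding up at most doubles it.\<close>
    have "(real R)\<^sup>2 \<le> 2 * real T"
      using R_le power_mono[of "real R" "sqrt (2 * real T)" 2] by simp
    then have "1 \<le> 2 * real T / (real R)\<^sup>2" using R by (simp add: field_simps)
    then have "real a \<le> 4 * real T / (real R)\<^sup>2" using a_upper by simp
    then have "2 * real a * real R \<le> 2 * (4 * real T / (real R)\<^sup>2) * real R"
      by (intro mult_left_mono mult_right_mono) auto
    also have "\<dots> = 8 * real T / real R" using R by (simp add: power2_eq_square)
    finally show ?thesis
      using \<mu> by (intro add_right_mono mult_left_mono) auto
  qed
  finally have main: "(real T + \<beta> - 1)\<^sup>2 * \<xi> T \<le> \<beta>\<^sup>2 * \<xi> 0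
      + (9 * L\<^sup>2 * \<sigma>\<^sup>2 / \<mu>^3 * (8 * real T / real R) + real T * (2 * L * \<sigma>\<^sup>2 / (m * \<mu>\<^sup>2)))"
    by simp
  have "(real T)\<^sup>2 * \<xi> T \<le> (real T + \<beta> - 1)\<^sup>2 * \<xi> T"
    using beta_ge_2 nonneg by (intro mult_right_mono power_mono) auto
  with main have "(real T)\<^sup>2 * \<xi> T \<le> \<beta>\<^sup>2 * \<xi> 0
      + (9 * L\<^sup>2 * \<sigma>\<^sup>2 / \<mu>^3 * (8 * real T / real R) + real T * (2 * L * \<sigma>\<^sup>2 / (m * \<mu>\<^sup>2)))"
    by linarith
  also have "\<dots> = (real T)\<^sup>2 * (\<beta>\<^sup>2 * \<xi> 0 / (real T)\<^sup>2 + 2 * L * \<sigma>\<^sup>2 / (m * \<mu>\<^sup>2 * real T)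
                + 72 * L\<^sup>2 * \<sigma>\<^sup>2 / (\<mu>^3 * real T * real R))"
    using T \<mu> m R by (simp add: field_simps power2_eq_square)
  finally show ?thesis
    using T by (simp only: mult_le_cancel_left_pos zero_less_power of_nat_0_less_iff)
qed

end

section \<open>The iterates of Local SGD\<close>

lemma subalgebra_generated:
  assumes "\<And>X. X \<in> \<X> \<Longrightarrow> X \<in> borel_measurable M"
  shows "subalgebra M (generated_algebra M \<X>)"
proof -
  define \<G> where "\<G> = {X -` A \<inter> space M | X A. X \<in> \<X> \<and> A \<in> sets borel}"
  have "\<G> \<subseteq> sets M"
    using assms by (auto simp: \<G>_def intro: measurable_sets)
  then have "sigma_sets (space M) \<G> \<subseteq> sets M"
    by (rule sets.sigma_sets_subset)
  moreover have "\<G> \<subseteq> Pow (space M)"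
    by (auto simp: \<G>_def)
  ultimately show ?thesis
    unfolding subalgebra_def generated_algebra_def \<G>_def[symmetric] by simp
qed

lemma measurable_generated:
  assumes "X \<in> \<X>"
  shows "X \<in> borel_measurable (generated_algebra M \<X>)"
proof (rule measurableI)
  fix A :: "'b set" assume "A \<in> sets borel"
  then have "X -` A \<inter> space M \<in> {X -` A \<inter> space M | X A. X \<in> \<X> \<and> A \<in> sets borel}"
    using assms by blast
  then have "X -` A \<inter> space M \<in> sets (generated_algebra M \<X>)"
    unfolding generated_algebra_def by (subst sets_measure_of) (auto intro: sigma_sets.Basic)
  then show "X -` A \<inter> space (generated_algebra M \<X>) \<in> sets (generated_algebra M \<X>)"
    by (simp add: generated_algebra_def space_measure_of_conv)
qed simp

text \<open>Measurability of the past and square integrability of the positions at time \<open>t\<close> are all that the noise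
  model leaves open; they come from the earlier iterates.\<close>

lemma noisy_gradients_history:
  assumes "prob_space M" "smooth_strongly_convex F gradF \<mu> L"
    and n: "n \<ge> 1" and c: "c \<ge> 0"
    and model: "noise_model M n T c \<sigma> gradF x g" and t: "t < T"
    and sq: "\<And>k i. k \<le> t \<Longrightarrow> i \<in> {1..n} \<Longrightarrow> square_integrable M (x k i)"
  shows "noisy_gradients M F gradF \<mu> L (history M n x g t) n c \<sigma> (x t) (g t)"
proof -
  interpret prob_space M by fact
  interpret smooth_strongly_convex F gradF \<mu> L by fact
  have g: "g k i \<in> borel_measurable M" if "k < T" "i \<in> {1..n}" for k i
    using model that unfolding noise_model_def by blast
  have sub: "subalgebra M (history M n x g t)"
    unfolding history_def
  proof (rule subalgebra_generated)
    have "x k i \<in> borel_measurable M" if "k \<le> t" "i \<in> {1..n}" for k i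
      using sq[OF that] by (rule square_integrable_measurable)
    then show "X \<in> borel_measurable M"
      if "X \<in> {x k i |k i. i \<in> {1..n} \<and> k < t} \<union> {g k i |k i. i \<in> {1..n} \<and> k < t} \<union> {x t i |i. i \<in> {1..n}}"
      for X
      using that g t by fastforce
  qed
  have past: "x t i \<in> borel_measurable (history M n x g t)" if "i \<in> {1..n}" for i
    unfolding history_def using that by (intro measurable_generated) blast
  let ?\<epsilon> = "\<lambda>i \<omega>. g t i \<omega> - gradF (x t i \<omega>)"
  have noise: "cond_indep_vars M (history M n x g t) ?\<epsilon> {1..n} \<and>
      (\<forall>i\<in>{1..n}. (AE \<omega> in M. vec_cond_exp M (history M n x g t) (?\<epsilon> i) \<omega> = 0) \<and>
         (AE \<omega> in M. nn_cond_exp M (history M n x g t) (\<lambda>\<xi>. ennreal ((norm (?\<epsilon> i \<xi>))\<^sup>2)) \<omega>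
                      \<le> ennreal (c * (norm (gradF (x t i \<omega>)))\<^sup>2 + \<sigma>\<^sup>2)))"
    using model t unfolding noise_model_def Let_def by blast
  show ?thesis
  proof (rule noisy_gradients.intro[OF assms(1,2)], rule noisy_gradients_axioms.intro[OF sub n c])
    fix i assume i: "i \<in> {1..n}"
    show "square_integrable M (x t i)" by (rule sq[OF order_refl i])
    show "x t i \<in> borel_measurable (history M n x g t)" by (rule past[OF i])
    show "AE \<omega> in M. vec_cond_exp M (history M n x g t) (?\<epsilon> i) \<omega> = 0"
      using noise i by blast
    show "AE \<omega> in M. nn_cond_exp M (history M n x g t) (\<lambda>\<xi>. ennreal ((norm (?\<epsilon> i \<xi>))\<^sup>2)) \<omega>
             \<le> ennreal (c * (norm (gradF (x t i \<omega>)))\<^sup>2 + \<sigma>\<^sup>2)"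
      using noise i by blast
  qed (rule conjunct1[OF noise])
qed

lemma local_sgd_Suc:
  "local_sgd n \<I> \<eta> x0 g (Suc t) i \<omega>
     = (if Suc t \<notin> \<I> then local_sgd n \<I> \<eta> x0 g t i \<omega> - \<eta> t *\<^sub>R g t i \<omega>
        else mean n (\<lambda>j. local_sgd n \<I> \<eta> x0 g t j \<omega> - \<eta> t *\<^sub>R g t j \<omega>))"
  by (simp only: local_sgd.simps mean_def)

text \<open>Communication replaces all iterates by their mean and hence leaves the mean unchanged.\<close>

lemma local_sgd_Suc_mean:
  assumes "n \<ge> 1"
  shows "mean n (\<lambda>i. local_sgd n \<I> \<eta> x0 g (Suc t) i \<omega>)
       = mean n (\<lambda>i. local_sgd n \<I> \<eta> x0 g t i \<omega> - \<eta> t *\<^sub>R g t i \<omega>)"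
  unfolding local_sgd_Suc
  by (cases "Suc t \<in> \<I>")
     (simp_all only: mean_const[OF assms] if_True if_False not_True_eq_False not_False_eq_True)

text \<open>By induction from the deterministic start: square-integrable positions have square-integrable
  gradients by the Lipschitz bound, hence noise of finite second moment, hence square-integrable
  successors.\<close>

lemma local_sgd_square_integrable:
  assumes "prob_space M" "smooth_strongly_convex F gradF \<mu> L"
    and n: "n \<ge> 1" and c: "c \<ge> 0"
    and x: "x = local_sgd n \<I> \<eta> x0 g" and model: "noise_model M n T c \<sigma> gradF x g"
  shows "t \<le> T \<Longrightarrow> i \<in> {1..n} \<Longrightarrow> square_integrable M (x t i)"
proof (induction t arbitrary: i rule: less_induct)
  case (less t)
  interpret prob_space M by fact
  show ?case
  proof (cases t)
    case 0
    then show ?thesis by (simp only: x local_sgd.simps(1) square_integrable_const)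
  next
    case (Suc s)
    interpret noisy_gradients M F gradF \<mu> L "history M n x g s" n c \<sigma> "x s" "g s"
      by (rule noisy_gradients_history[OF assms(1,2) n c model]) (use less Suc in auto)
    show ?thesis
    proof (cases "Suc s \<in> \<I>")
      case True
      then have "x t i = (\<lambda>\<omega>. mean n (\<lambda>j. x s j \<omega> - \<eta> s *\<^sub>R g s j \<omega>))"
        unfolding x Suc local_sgd_Suc[abs_def] by (simp only: if_False not_True_eq_False)
      then show ?thesis
        by (simp only: mean_sq step_sq)
    next
      case False
      then have "x t i = (\<lambda>\<omega>. x s i \<omega> - \<eta> s *\<^sub>R g s i \<omega>)"
        unfolding x Suc local_sgd_Suc[abs_def] by (simp only: if_True not_False_eq_True)
      then show ?thesis
        by (simp only: step_sq[OF less.prems(2)])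
    qed
  qed
qed

theorem theorem2:
  fixes M :: "'w measure"
    and F :: "'a::euclidean_space \<Rightarrow> real" and gradF :: "'a \<Rightarrow> 'a"
    and \<mu> L \<kappa> c \<sigma> \<beta> :: real
    and n T R a :: nat
    and H :: "nat \<Rightarrow> nat" and \<I> :: "nat set"
    and \<eta> :: "nat \<Rightarrow> real"
    and x0 :: 'a
    and x g :: "nat \<Rightarrow> nat \<Rightarrow> 'w \<Rightarrow> 'a"
  assumes "prob_space M"
    and "\<And>y. GDERIV F y :> gradF y"
    and "strongly_convex_smooth \<mu> L F gradF"
    and "L \<ge> \<mu>" and "\<mu> > 0"
    and "\<kappa> = L / \<mu>"
    and "n \<ge> 1" and "T \<ge> 1"
    and "c \<ge> 0"
    and "1 \<le> R" and "real R \<le> sqrt (2 * real T)"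
    and "a = nat \<lceil>2 * real T / (real R)\<^sup>2\<rceil>"
    and "\<And>i. H i = a * (i + 1)"
    and "\<I> = comm_time H T ` {1..R}"
    and "\<beta> \<ge> max (2 * \<kappa>\<^sup>2)
                 (9 * \<kappa>\<^sup>2 * c * max (ln 3) (ln (1 + real T / ((real R)\<^sup>2 * \<kappa>\<^sup>2)))
                   + 2 * \<kappa> * (1 + c / real n))"
    and "\<And>t. t < T \<Longrightarrow> \<eta> t = 2 / (\<mu> * (real t + \<beta>))"
    and "x = local_sgd n \<I> \<eta> x0 g"
    and "noise_model M n T c \<sigma> gradF x g"
  shows "prob_space.expectation M (\<lambda>\<omega>. F (average_iterate n x T \<omega>)) - min_value F
           \<le> \<beta>\<^sup>2 * (F x0 - min_value F) / (real T)\<^sup>2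
             + 2 * L * \<sigma>\<^sup>2 / (real n * \<mu>\<^sup>2 * real T)
             + 72 * L\<^sup>2 * \<sigma>\<^sup>2 / (\<mu>^3 * real T * real R)"
proof -
  interpret prob_space M by fact
  interpret smooth_strongly_convex F gradF \<mu> L
    by unfold_locales fact+
  note x = \<open>x = local_sgd n \<I> \<eta> x0 g\<close> and model = \<open>noise_model M n T c \<sigma> gradF x g\<close>
    and n = \<open>n \<ge> 1\<close> and c = \<open>c \<ge> 0\<close> and step = assms(16)
  have sq: "square_integrable M (x t i)" if "t \<le> T" "i \<in> {1..n}" for t i
    by (rule local_sgd_square_integrable[OF \<open>prob_space M\<close> _ n c x model that]) unfold_locales
  have noisy: "noisy_gradients M F gradF \<mu> L (history M n x g t) n c \<sigma> (x t) (g t)" if "t < T" for t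
    by (rule noisy_gradients_history[OF \<open>prob_space M\<close> _ n c model that])
       (use that sq in \<open>auto intro: smooth_strongly_convex_axioms\<close>)
  define z where "z = (\<lambda>t \<omega>. mean n (\<lambda>i. x t i \<omega>))"
  define \<xi> where "\<xi> = (\<lambda>t. (\<integral>\<omega>. F (z t \<omega>) \<partial>M) - min_value F)"
  define V where "V = (\<lambda>t. \<integral>\<omega>. spread n (\<lambda>i. x t i \<omega>) \<partial>M)"
  define G where "G = (\<lambda>t. (\<Sum>i\<in>{1..n}. \<integral>\<omega>. (norm (gradF (x t i \<omega>)))\<^sup>2 \<partial>M) / real n)"
  have \<kappa>: "\<kappa> \<ge> 1" using assms(4-6) by simp
  have \<beta>: "\<beta> \<ge> 2 * \<kappa>\<^sup>2"
    and large: "\<beta> \<ge> 9 * \<kappa>\<^sup>2 * c * max (ln 3) (ln (1 + real T / ((real R)\<^sup>2 * \<kappa>\<^sup>2)))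
                 + 2 * \<kappa> * (1 + c / real n)"
    using assms(15) by (simp_all only: max.bounded_iff)
  have \<beta>_pos: "\<beta> > 0" using \<beta> \<kappa> by (smt (verit) one_le_power)
  have \<eta>_nonneg: "\<eta> t \<ge> 0" if "t < T" for t
    using step[OF that] \<beta>_pos mu_pos by simp
  have \<eta>_small: "\<eta> t * L \<le> 1" if "t < T" for t
  proof -
    have "2 * \<kappa> * 1 \<le> 2 * \<kappa> * \<kappa>" using \<kappa> by (intro mult_left_mono) auto
    then have "2 * \<kappa> \<le> real t + \<beta>"
      using \<beta> by (simp add: power2_eq_square)
    then have "2 * L \<le> \<mu> * (real t + \<beta>)"
      using mu_pos by (simp add: assms(6) field_simps)
    then show ?thesis
      using step[OF that] mu_pos \<beta>_pos by (simp add: divide_le_eq)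
  qed
  have \<xi>_nonneg: "0 \<le> \<xi> t" if "t \<le> T" for t
  proof -
    have "square_integrable M (z t)"
      unfolding z_def mean_def using sq that by (intro square_integrable_scaleR square_integrable_sum)
    then have "integrable M (\<lambda>\<omega>. F (z t \<omega>))"
      by (intro integrable_objective) unfold_locales
    then have "(\<integral>\<omega>. min_value F \<partial>M) \<le> (\<integral>\<omega>. F (z t \<omega>) \<partial>M)"
      by (intro integral_mono min_value_le) auto
    then show ?thesis by (simp add: \<xi>_def prob_space)
  qed
  have sync: "V t = 0" if "t = 0 \<or> t \<in> \<I>" for t
  proof -
    have "x t i \<omega> - x t j \<omega> = 0" for i j \<omega> using that by (cases t) (auto simp: x)
    then have "spread n (\<lambda>i. x t i \<omega>) = 0" for \<omega>
      unfolding spread_def by (simp only: norm_zero) simp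
    then show ?thesis by (simp only: V_def) simp
  qed
  have "\<xi> T \<le> \<beta>\<^sup>2 * \<xi> 0 / (real T)\<^sup>2 + 2 * L * \<sigma>\<^sup>2 / (real n * \<mu>\<^sup>2 * real T)
                + 72 * L\<^sup>2 * \<sigma>\<^sup>2 / (\<mu>^3 * real T * real R)"
  proof (rule recursion_solution[OF \<open>1 \<le> R\<close> assms(12,13) \<kappa> \<beta> mu_pos \<open>\<kappa> = L / \<mu>\<close> \<open>T \<ge> 1\<close>
        assms(11) c _ assms(14) large step \<xi>_nonneg])
    show "V (Suc t) \<le> (1 - \<mu> * \<eta> t) * V t + (\<eta> t)\<^sup>2 * (c * G t + \<sigma>\<^sup>2)"
      if t: "t < T" "Suc t \<notin> \<I>" for t
    proof -
      interpret noisy_gradients M F gradF \<mu> L "history M n x g t" n c \<sigma> "x t" "g t"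
        by (rule noisy[OF t(1)])
      have "x (Suc t) i \<omega> = x t i \<omega> - \<eta> t *\<^sub>R g t i \<omega>" for i \<omega>
        unfolding x local_sgd_Suc using t by (simp only: if_True not_False_eq_True)
      then show ?thesis
        using expected_spread_step[OF \<eta>_nonneg[OF t(1)] \<eta>_small[OF t(1)]]
        by (simp only: V_def G_def gradient_energy_def)
    qed
    show "\<xi> (Suc t) \<le> (1 - \<mu> * \<eta> t) * \<xi> t + (\<eta> t * L\<^sup>2 / 2 * V t
        - \<eta> t / 2 * (1 - L * \<eta> t * (1 + c / real n)) * G t + L * (\<eta> t)\<^sup>2 * \<sigma>\<^sup>2 / (2 * real n))"
      if t: "t < T" for t
    proof -
      interpret noisy_gradients M F gradF \<mu> L "history M n x g t" n c \<sigma> "x t" "g t"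
        by (rule noisy[OF t])
      have "z (Suc t) \<omega> = mean n (\<lambda>i. x t i \<omega> - \<eta> t *\<^sub>R g t i \<omega>)" for \<omega>
        unfolding z_def x by (rule local_sgd_Suc_mean[OF n])
      then show ?thesis
        using expected_descent[OF \<eta>_nonneg[OF t]]
        by (simp only: \<xi>_def V_def G_def gradient_energy_def z_def)
    qed
    show "0 \<le> V t" for t
      unfolding V_def spread_def by (intro Bochner_Integration.integral_nonneg divide_nonneg_nonneg sum_nonneg) auto
    show "0 \<le> G t" for t
      unfolding G_def by (intro divide_nonneg_nonneg sum_nonneg Bochner_Integration.integral_nonneg) auto
    show "V 0 = 0" using sync by blast
    show "V t = 0" if "t \<in> \<I>" for t using sync that by blast
    show "0 < real n" using n by simp
  qed
  moreover have z_eq: "average_iterate n x T = z T"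
    by (simp only: z_def mean_def average_iterate_def[abs_def])
  moreover have "z 0 \<omega> = x0" for \<omega>
    unfolding z_def x local_sgd.simps(1) by (rule mean_const[OF n])
  ultimately show ?thesis
    by (simp add: \<xi>_def z_eq prob_space)
qed

end
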